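(* $[4,0,1,0]=5$. That is: let $n\ge 5$, let $r,r_1,r_2$ be three distinct red vertices and $g,g_1,g_2$ be three distinct green vertices in $\mathcal{Q}_n$. Then there exists a Hamiltonian path of $\mathcal{Q}_n-\{r_1,r_2,g_1,g_2\}$ that connects $r$ to $g$. The claim is not true if $n=3$ or $n=4$ (for each of these $n$ there are such vertices for which no such Hamiltonian path exists).
   Context: $\mathcal{Q}_n$ is the $n$-dimensional binary hypercube: its vertices are all binary sequences of length $n$, adjacent iff they differ in exactly one position. A vertex is even or odd according to the parity of its number of 1's; vertices of one parity are called red and those of the other parity green. A path covering of a graph is a set of vertex-disjoint paths that cover all vertices of the graph. A fault $\mathcal{F}$ in $\mathcal{Q}_n$ is a set of deleted vertices; its mass is $|\mathcal{F}|$ and its charge is $|r(\mathcal{F})-g(\mathcal{F})|$, where $r(\mathcal{F})$, $g(\mathcal{F})$ are the numbers of red and green vertices in $\mathcal{F}$. $\mathcal{Q}_n-\mathcal{F}$ is the subgraph induced by the non-deleted vertices. A pair of vertices (or a path, via its two endpoints) is neutral if the two vertices have opposite parity and charged if they have the same parity; a charged pair is red (green) if its elements are red (green). A set $\mathcal{E}$ of disjoint pairs of vertices is in balance with $\mathcal{F}$ if all vertices in the pairs lie in $\mathcal{Q}_n-\mathcal{F}$ and $r(\mathcal{F})-g(\mathcal{F})=g(\mathcal{E})-r(\mathcal{E})$, where $r(\mathcal{E})$, $g(\mathcal{E})$ are the numbers of red and green pairs in $\mathcal{E}$. For a fault $\mathcal{F}$ of mass $M$ and charge $C$ in $\mathcal{Q}_n$,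 one can freely prescribe ends for a path covering of $\mathcal{Q}_n-\mathcal{F}$ with $N$ neutral paths and $O$ charged paths if (i) there is at least one set $\mathcal{E}$ of disjoint pairs of vertices in balance with $\mathcal{F}$ containing exactly $N$ neutral and $O$ charged pairs, and (ii) for every such $\mathcal{E}$ there is a path covering of $\mathcal{Q}_n-\mathcal{F}$ whose set of pairs of end vertices is $\mathcal{E}$. For nonnegative integers $M,C,N,O$, $\mathcal{A}_{M,C,N,O}$ is the set of nonnegative integers $m$ such that $m\ge\log_2[M+C+2N+2O]$ and for every $n\ge m$ and every fault $\mathcal{F}$ of mass $M$ and charge $C$ in $\mathcal{Q}_n$ one can freely prescribe ends for a path covering of $\mathcal{Q}_n-\mathcal{F}$ with $N$ neutral and $O$ charged paths. $[M,C,N,O]$ is the smallest element of $\mathcal{A}_{M,C,N,O}$ if this set is nonempty. *)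

theory Defs
  imports Complex_Main "Graph_Theory.Graph_Theory"
begin

text \<open>The undirected hypercube is rendered as a symmetric digraph without parallel arcs:
  an edge \<open>{u, v}\<close> becomes the two arcs \<open>(u, v)\<close> and \<open>(v, u)\<close>.\<close>

definition hypercube :: "nat \<Rightarrow> (bool list, bool list \<times> bool list) pre_digraph" where
  "hypercube n =
    \<lparr> verts = {v. length v = n},
      arcs = {(u, v). length u = n \<and> length v = n \<and> card {i. i < n \<and> u ! i \<noteq> v ! i} = 1},
      tail = fst, head = snd \<rparr>"

text \<open>Which parity is called red is immaterial, as all notions below are invariant under
  exchanging the two colours.\<close>

definition red :: "bool list \<Rightarrow> bool" where
  "red v \<longleftrightarrow> even (count_list v True)"

definition green :: "bool list \<Rightarrow> bool" where
  "green v \<longleftrightarrow> odd (count_list v True)"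

definition delete_verts :: "('a, 'b) pre_digraph \<Rightarrow> 'a set \<Rightarrow> ('a, 'b) pre_digraph" where
  "delete_verts G F = G \<restriction> (verts G - F)"

definition hamiltonian_path :: "('a, 'b) pre_digraph \<Rightarrow> 'a list \<Rightarrow> bool" where
  "hamiltonian_path G p \<longleftrightarrow> vpath p G \<and> set p = verts G"

text \<open>Disjointness is required of any two distinct lists (rather than of the family of their
  vertex sets), so that a path is never listed together with its reversal.\<close>

definition path_covering :: "('a, 'b) pre_digraph \<Rightarrow> 'a list set \<Rightarrow> bool" where
  "path_covering G P \<longleftrightarrow>
    (\<forall>p\<in>P. vpath p G) \<and> pairwise (\<lambda>p q. disjnt (set p) (set q)) P \<and> (\<Union>p\<in>P. set p) = verts G"

definition path_ends :: "'a list \<Rightarrow> 'a set" where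
  "path_ends p = {hd p, last p}"

definition fault :: "nat \<Rightarrow> bool list set \<Rightarrow> bool" where
  "fault n F \<longleftrightarrow> F \<subseteq> verts (hypercube n)"

definition num_red :: "bool list set \<Rightarrow> nat" where
  "num_red F = card {v \<in> F. red v}"

definition num_green :: "bool list set \<Rightarrow> nat" where
  "num_green F = card {v \<in> F. green v}"

definition mass :: "bool list set \<Rightarrow> nat" where
  "mass F = card F"

definition charge :: "bool list set \<Rightarrow> nat" where
  "charge F = nat \<bar>int (num_red F) - int (num_green F)\<bar>"

text \<open>A pair of vertices is an unordered pair of two distinct vertices.\<close>

definition is_pair :: "bool list set \<Rightarrow> bool" where
  "is_pair e \<longleftrightarrow> card e = 2"

definition neutral_pair :: "bool list set \<Rightarrow> bool" where
  "neutral_pair e \<longleftrightarrow> is_pair e \<and> (\<exists>u\<in>e. red u) \<and> (\<exists>v\<in>e. green v)"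

definition red_pair :: "bool list set \<Rightarrow> bool" where
  "red_pair e \<longleftrightarrow> is_pair e \<and> (\<forall>v\<in>e. red v)"

definition green_pair :: "bool list set \<Rightarrow> bool" where
  "green_pair e \<longleftrightarrow> is_pair e \<and> (\<forall>v\<in>e. green v)"

definition charged_pair :: "bool list set \<Rightarrow> bool" where
  "charged_pair e \<longleftrightarrow> red_pair e \<or> green_pair e"

definition in_balance :: "nat \<Rightarrow> bool list set \<Rightarrow> bool list set set \<Rightarrow> bool" where
  "in_balance n F E \<longleftrightarrow>
    (\<forall>e\<in>E. is_pair e \<and> e \<subseteq> verts (delete_verts (hypercube n) F)) \<and>
    pairwise disjnt E \<and>
    int (num_red F) - int (num_green F)
      = int (card {e \<in> E. green_pair e}) - int (card {e \<in> E. red_pair e})"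

definition admissible_ends ::
    "nat \<Rightarrow> bool list set \<Rightarrow> nat \<Rightarrow> nat \<Rightarrow> bool list set set \<Rightarrow> bool" where
  "admissible_ends n F N K E \<longleftrightarrow>
    in_balance n F E \<and> card {e \<in> E. neutral_pair e} = N \<and> card {e \<in> E. charged_pair e} = K"

definition freely_prescribe_ends :: "nat \<Rightarrow> bool list set \<Rightarrow> nat \<Rightarrow> nat \<Rightarrow> bool" where
  "freely_prescribe_ends n F N K \<longleftrightarrow>
    (\<exists>E. admissible_ends n F N K E) \<and>
    (\<forall>E. admissible_ends n F N K E \<longrightarrow>
      (\<exists>P. path_covering (delete_verts (hypercube n) F) P \<and> path_ends ` P = E))"

text \<open>\<open>K\<close> is the number of charged paths. If all four parameters vanish, the logarithm is
  that of \<open>0\<close>; then \<open>log 2 0 = 0\<close> imposes no condition on \<open>m\<close>, just as the value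
  \<open>-\<infinity>\<close> would.\<close>

definition A_set :: "nat \<Rightarrow> nat \<Rightarrow> nat \<Rightarrow> nat \<Rightarrow> nat set" where
  "A_set M C N K =
    {m. real m \<ge> log 2 (real (M + C + 2 * N + 2 * K)) \<and>
        (\<forall>n\<ge>m. \<forall>F. fault n F \<and> mass F = M \<and> charge F = C \<longrightarrow> freely_prescribe_ends n F N K)}"

text \<open>Only meaningful if \<open>A_set M C N K\<close> is nonempty.\<close>

definition bracket :: "nat \<Rightarrow> nat \<Rightarrow> nat \<Rightarrow> nat \<Rightarrow> nat" where
  "bracket M C N K = (LEAST m. m \<in> A_set M C N K)"

definition three_red_three_green ::
    "nat \<Rightarrow> bool list \<Rightarrow> bool list \<Rightarrow> bool list \<Rightarrow> bool list \<Rightarrow> bool list \<Rightarrow> bool list \<Rightarrow> bool" where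
  "three_red_three_green n r r1 r2 g g1 g2 \<longleftrightarrow>
    {r, r1, r2, g, g1, g2} \<subseteq> verts (hypercube n) \<and>
    red r \<and> red r1 \<and> red r2 \<and> distinct [r, r1, r2] \<and>
    green g \<and> green g1 \<and> green g2 \<and> distinct [g, g1, g2]"

end

theory Submission
  imports Defs
begin

text \<open>The heart of the matter is that for \<open>n \<ge> 5\<close> the cube \<open>Q\<^sub>n\<close> without two red and two green
vertices has a Hamiltonian path between any two remaining vertices \<open>r\<close>, \<open>g\<close> of different colours
(\<open>cube_minus_four_path\<close>). Fixing one coordinate cuts \<open>Q\<^sub>n\<close> into two copies of \<open>Q\<^bsub>n-1\<^esub>\<close>, each
vertex being joined to its twin in the other copy. The coordinate is chosen so that it separates
the two red faults \<open>r\<^sub>1\<close>, \<open>r\<^sub>2\<close>, and then no half has all the faults: either each half has one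
fault of each colour, or a single red fault is alone in its half. In the first case a path in
each half suffices, crossing once or making a detour through the other half. In the second case
the half with three faults is treated as if one green fault were still present: a path through
that half is found, and the fault is then cut out of it, leaving two paths (or one, if it was an
end) whose loose ends are linked through the half with the single fault. No induction on the
theorem itself is needed; this is why it starts to hold at \<open>n = 5\<close>, as soon as the halves
satisfy the following facts with fewer deleted vertices:

  \<^item> \<open>cube_one_path\<close>: nothing deleted, ends of different colours (\<open>n \<ge> 1\<close>);
  \<^item> \<open>cube_minus_one_path\<close>: one vertex deleted, both ends of the other colour (\<open>n \<ge> 2\<close>);
  \<^item> \<open>cube_two_paths\<close>: two neutral paths with prescribed ends (\<open>n \<ge> 3\<close>);
  \<^item> \<open>cube_minus_one_two_paths\<close>: one vertex deleted, a neutral and a charged path with prescribed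
    ends (\<open>n \<ge> 4\<close>);
  \<^item> \<open>cube_minus_two_path\<close>: one vertex of each colour deleted, a neutral path (\<open>n \<ge> 4\<close>).

Each of these is proved by induction on \<open>n\<close>, again by choosing a coordinate that separates two
particular vertices. The last two fail for \<open>n = 3\<close>, but their induction steps use so little of
the hypothesis that a weaker form of it, true for \<open>n = 3\<close>, gives the case \<open>n = 4\<close>. So the only
finite verifications take place in \<open>Q\<^sub>3\<close>; they and the two counterexamples in \<open>Q\<^sub>3\<close> and \<open>Q\<^sub>4\<close>
are exhaustive searches carried out by the simplifier.

In the counterexample in \<open>Q\<^sub>4\<close> the ends are \<open>r = 0000\<close> and \<open>g = 1011\<close> and the faults are 0011,
0101, 1000, 1110. The vertices 0001, 1010, 1100 and 0111 have only two remaining neighbours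
each, so a path contains 0000--0001--1001, 0010--1010--1011, 0100--1100--1101 and
0110--0111--1111. Hence the ends 0000 and 1011 have no other edge, 1001 must continue to 1101,
and 1111 has no neighbour left but 1101, which is saturated.

Finally, the bracket is reduced to this fact: a set of ends with one neutral pair \<open>{r, g}\<close>
admits a covering if and only if there is a Hamiltonian path from \<open>r\<close> to \<open>g\<close>.\<close>

section \<open>Adjacency, colours and vertices of the cube\<close>

text \<open>The recursive form of adjacency makes it immediate how inserting a bit affects it. It is
compared with the number of differing positions in \<open>adj_iff_card\<close>.\<close>

fun adj :: "bool list \<Rightarrow> bool list \<Rightarrow> bool" where
  "adj (x # u) (y # v) \<longleftrightarrow> (if x = y then adj u v else u = v)"
| "adj _ _ \<longleftrightarrow> False"

lemma adj_commute: "adj u v \<longleftrightarrow> adj v u"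
  by (induction u v rule: adj.induct) auto

lemma adj_imp_flip: "adj u v \<Longrightarrow> \<exists>i<length v. u = v[i := \<not> v ! i]"
proof (induction u v rule: adj.induct)
  case (1 x u y v)
  show ?case
  proof (cases "x = y")
    case True
    with 1 obtain i where "i < length v" "u = v[i := \<not> v ! i]" by auto
    with True show ?thesis by (intro exI[of _ "Suc i"]) simp
  next
    case False
    with 1 show ?thesis by (intro exI[of _ 0]) auto
  qed
qed auto

lemma red_Nil [simp]: "red []"
  by (simp add: red_def)

lemma red_Cons [simp]: "red (x # v) \<longleftrightarrow> red v \<noteq> x"
  by (auto simp: red_def)

lemma adj_red: "adj u v \<Longrightarrow> red u \<noteq> red v"
  by (induction u v rule: adj.induct) (auto split: if_splits)

lemma green_iff: "green v \<longleftrightarrow> \<not> red v"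
  by (simp add: green_def red_def)

definition cube :: "nat \<Rightarrow> bool list set" where
  "cube n = {v. length v = n}"

lemma finite_cube [simp]: "finite (cube n)"
  using finite_lists_length_eq[of "UNIV :: bool set" n] by (simp add: cube_def)

lemma card_cube: "card (cube n) = 2 ^ n"
  using card_lists_length_eq[of "UNIV :: bool set" n] by (simp add: cube_def)

text \<open>A vertex of given colour is determined by all its bits but the first, which are arbitrary.\<close>

lemma card_colour_class: "card {v \<in> cube (Suc n). red v = c} = 2 ^ n"
proof -
  have "{v \<in> cube (Suc n). red v = c} = (\<lambda>u. (red u \<noteq> c) # u) ` cube n"
    by (auto simp: cube_def length_Suc_conv image_iff)
  moreover have "inj_on (\<lambda>u. (red u \<noteq> c) # u) (cube n)"
    by (auto simp: inj_on_def)
  ultimately show ?thesis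
    by (simp add: card_image card_cube)
qed

lemma card_colour_class_minus:
  assumes "finite X" "0 < n"
  shows "2 ^ (n - 1) - card X \<le> card {v \<in> cube n - X. red v = c}"
proof -
  have "{v \<in> cube n - X. red v = c} = {v \<in> cube n. red v = c} - X" by auto
  moreover have "card {v \<in> cube n. red v = c} = 2 ^ (n - 1)"
    using card_colour_class[of "n - 1" c] assms(2) by simp
  ultimately show ?thesis
    using diff_card_le_card_Diff[OF assms(1), of "{v \<in> cube n. red v = c}"] by simp
qed

text \<open>All auxiliary vertices are chosen with this lemma; the listed vertices need not be
distinct.\<close>

lemma ex_vertex_avoiding:
  assumes "length xs < 2 ^ (n - 1)" "0 < n"
  obtains v where "v \<in> cube n" "red v = c" "v \<notin> set xs"
proof -
  have "0 < card {v \<in> cube n - set xs. red v = c}"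
    using card_colour_class_minus[OF finite_set assms(2), of xs c] assms(1) card_length[of xs]
    by linarith
  then show ?thesis using that by (auto simp: card_gt_0_iff)
qed

section \<open>Paths and pairs of disjoint paths\<close>

text \<open>\<open>path_on S a b\<close> describes a path by its vertex set and its two ends only. A Hamiltonian
path of \<open>Q\<^sub>n\<close> without \<open>F\<close> from \<open>a\<close> to \<open>b\<close> is thus \<open>path_on (cube n - F) a b\<close>, and gluing paths
amounts to taking unions of sets.\<close>

inductive path_on :: "bool list set \<Rightarrow> bool list \<Rightarrow> bool list \<Rightarrow> bool" where
  single: "path_on {a} a a"
| step: "path_on S b c \<Longrightarrow> adj a b \<Longrightarrow> a \<notin> S \<Longrightarrow> path_on (insert a S) a c"

lemma path_on_finite: "path_on S a b \<Longrightarrow> finite S"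
  by (induction rule: path_on.induct) auto

lemma path_on_ends: "path_on S a b \<Longrightarrow> a \<in> S \<and> b \<in> S"
  by (induction rule: path_on.induct) auto

lemma path_on_same_ends: "path_on S a b \<Longrightarrow> a = b \<Longrightarrow> S = {a}"
  by (induction rule: path_on.induct) (auto dest: path_on_ends)

lemma path_on_append:
  "path_on S a b \<Longrightarrow> adj b c \<Longrightarrow> path_on T c d \<Longrightarrow> S \<inter> T = {} \<Longrightarrow> path_on (S \<union> T) a d"
proof (induction arbitrary: rule: path_on.induct)
  case (single a)
  then show ?case using path_on.step[of T c d a] by auto
next
  case (step S b c' a)
  then have "path_on (S \<union> T) b d" by auto
  then show ?case using path_on.step[of "S \<union> T" b d a] step by auto
qed

lemma path_on_rev: "path_on S a b \<Longrightarrow> path_on S b a"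
proof (induction rule: path_on.induct)
  case (single a)
  then show ?case by (rule path_on.single)
next
  case (step S b c a)
  have "path_on (S \<union> {a}) c a"
    using step path_on.single by (intro path_on_append[of S c b a]) (auto simp: adj_commute)
  then show ?case by simp
qed

lemma path_on_drop_end:
  assumes "path_on S a b" "a \<noteq> b"
  obtains x where "path_on (S - {b}) a x" "adj x b"
proof -
  from path_on_rev[OF assms(1)] obtain x T where
    "path_on T x a" "adj b x" "b \<notin> T" "S = insert b T"
    using assms(2) by (auto elim: path_on.cases)
  then show ?thesis using that[of x] by (simp add: path_on_rev adj_commute)
qed

definition paths_on ::
    "bool list set \<Rightarrow> bool list \<Rightarrow> bool list \<Rightarrow> bool list \<Rightarrow> bool list \<Rightarrow> bool" where
  "paths_on S a b c d \<longleftrightarrow>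
    (\<exists>S\<^sub>1 S\<^sub>2. S = S\<^sub>1 \<union> S\<^sub>2 \<and> S\<^sub>1 \<inter> S\<^sub>2 = {} \<and> path_on S\<^sub>1 a b \<and> path_on S\<^sub>2 c d)"

lemma paths_onI:
  "path_on S\<^sub>1 a b \<Longrightarrow> path_on S\<^sub>2 c d \<Longrightarrow> S = S\<^sub>1 \<union> S\<^sub>2 \<Longrightarrow> S\<^sub>1 \<inter> S\<^sub>2 = {} \<Longrightarrow> paths_on S a b c d"
  by (auto simp: paths_on_def)

lemma paths_on_ends:
  "paths_on S a b c d \<Longrightarrow> a \<in> S \<and> b \<in> S \<and> c \<in> S \<and> d \<in> S \<and> a \<noteq> c \<and> a \<noteq> d \<and> b \<noteq> c \<and> b \<noteq> d"
  by (auto simp: paths_on_def dest!: path_on_ends)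

lemma paths_on_swap: "paths_on S a b c d \<Longrightarrow> paths_on S c d a b"
  unfolding paths_on_def by blast

lemma paths_on_rev1: "paths_on S a b c d \<Longrightarrow> paths_on S b a c d"
  unfolding paths_on_def using path_on_rev by blast

lemma paths_on_rev2: "paths_on S a b c d \<Longrightarrow> paths_on S a b d c"
  unfolding paths_on_def using path_on_rev by blast

lemma paths_on_step:
  assumes "paths_on S b c x y" "adj a b" "a \<notin> S"
  shows "paths_on (insert a S) a c x y"
proof -
  from assms(1) obtain S1 S2 where S: "S = S1 \<union> S2" "S1 \<inter> S2 = {}" "path_on S1 b c" "path_on S2 x y"
    by (auto simp: paths_on_def)
  show ?thesis
    using S assms(3) by (intro paths_onI[OF path_on.step[OF S(3) assms(2)] S(4)]) auto
qed

text \<open>This turns a path through a cube with few faults into two paths that avoid one more fault;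
the new ends are neighbours of the removed vertex and therefore have equal colour.\<close>

lemma path_on_remove_vertex:
  assumes "path_on S a b" "v \<in> S" "v \<noteq> a" "v \<noteq> b"
  obtains x y where "paths_on (S - {v}) a x y b" "adj x v" "adj v y"
proof -
  have "\<exists>x y. paths_on (S - {v}) a x y b \<and> adj x v \<and> adj v y"
    using assms
  proof (induction rule: path_on.induct)
    case (single a)
    then show ?case by simp
  next
    case (step S b c a)
    show ?case
    proof (cases "v = b")
      case True
      from step.hyps(1) obtain y T where T: "path_on T y c" "adj b y" "b \<notin> T" "S = insert b T"
        using True step.prems by (auto elim: path_on.cases)
      have "paths_on (insert a S - {v}) a a y c"
        using T True step by (intro paths_onI[OF path_on.single T(1)]) auto
      then show ?thesis using T(2) True step.hyps(2) by blast
    next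
      case False
      then obtain x y where xy: "paths_on (S - {v}) b x y c" "adj x v" "adj v y"
        using step by auto
      have "paths_on (insert a (S - {v})) a x y c"
        using paths_on_step[OF xy(1) step.hyps(2)] step.hyps(3) by auto
      moreover have "insert a (S - {v}) = insert a S - {v}" using step.prems by auto
      ultimately show ?thesis using xy(2,3) by auto
    qed
  qed
  then show ?thesis using that by blast
qed

text \<open>Colours alternate along a path. Consider the edges that lead, in the direction of the
path, from colour \<open>k\<close> to the other colour. They are pairwise disjoint, so every vertex of \<open>X\<close>
spoils at most one of them. Each vertex not coloured \<open>k\<close> is the head of such an edge, except the
start of the path if it is such a vertex; this is why the second bound is larger by one, where
the start need not be counted in \<open>X\<close>.\<close>

lemma path_on_cut_edge_aux:
  assumes "path_on S a b" "finite X"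
    "if red a = k then card X < card {v \<in> S. red v \<noteq> k}
     else card (X - {a}) + 1 < card {v \<in> S. red v \<noteq> k}"
  shows "\<exists>x y. paths_on S a x y b \<and> adj x y \<and> red x = k \<and> x \<notin> X \<and> y \<notin> X"
  using assms
proof (induction arbitrary: X rule: path_on.induct)
  case (single a)
  have "{v \<in> {a}. red v \<noteq> k} = (if red a = k then {} else {a})" by auto
  then show ?case using single by (auto split: if_splits)
next
  case (step S b c a)
  note fin = path_on_finite[OF step.hyps(1)]
  have ab: "red a \<noteq> red b" using step.hyps(2) by (rule adj_red)
  have rec: "\<exists>x y. paths_on (insert a S) a x y c \<and> adj x y \<and> red x = k \<and> x \<notin> X \<and> y \<notin> X"
    if "if red b = k then card (X - {a}) < card {v \<in> S. red v \<noteq> k}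
     else card (X - {a} - {b}) + 1 < card {v \<in> S. red v \<noteq> k}"
  proof -
    from step.IH[of "X - {a}"] that step.prems(1) obtain x y where
      xy: "paths_on S b x y c" "adj x y" "red x = k" "x \<notin> X - {a}" "y \<notin> X - {a}" by auto
    moreover have "x \<noteq> a" "y \<noteq> a" using paths_on_ends[OF xy(1)] step.hyps(3) by auto
    ultimately show ?thesis using paths_on_step[OF xy(1) step.hyps(2,3)] by blast
  qed
  show ?case
  proof (cases "red a = k")
    case True
    then have N: "{v \<in> insert a S. red v \<noteq> k} = {v \<in> S. red v \<noteq> k}" by auto
    have lt: "card X < card {v \<in> S. red v \<noteq> k}" using step.prems(2) True N by simp
    show ?thesis
    proof (cases "a \<in> X \<or> b \<in> X")
      case True2: True
      have "card (X - {a} - {b}) < card X"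
        using True2 step.prems(1) by (intro psubset_card_mono) auto
      then show ?thesis using lt True ab by (intro rec) auto
    next
      case False
      have "paths_on (insert a S) a a b c"
        using step.hyps by (intro paths_onI[OF path_on.single step.hyps(1)]) auto
      then show ?thesis using False True step.hyps(2) by blast
    qed
  next
    case False
    then have "{v \<in> insert a S. red v \<noteq> k} = insert a {v \<in> S. red v \<noteq> k}" by auto
    then have "card {v \<in> insert a S. red v \<noteq> k} = Suc (card {v \<in> S. red v \<noteq> k})"
      using fin step.hyps(3) by simp
    then show ?thesis using step.prems(2) False ab by (intro rec) auto
  qed
qed

text \<open>If the ends of the cut edge avoid the twins of the vertices \<open>xs\<close>, the cut can be bridged
by a path in the other half.\<close>

lemma path_on_cut_edge:
  assumes "path_on S a b" "length xs < card {v \<in> S. red v \<noteq> red a}"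
  obtains x y where "paths_on S a x y b" "adj x y" "red x = red a" "x \<notin> set xs" "y \<notin> set xs"
proof -
  have "card (set xs) < card {v \<in> S. red v \<noteq> red a}"
    using assms(2) card_length[of xs] by linarith
  then show ?thesis using path_on_cut_edge_aux[OF assms(1), of "set xs" "red a"] that by auto
qed

section \<open>Splitting the cube into two halves\<close>

text \<open>\<open>ins_bit i True\<close> and \<open>ins_bit i False\<close> embed \<open>cube n\<close> as the two halves of \<open>cube (Suc n)\<close>
with respect to coordinate \<open>i\<close>. For \<open>i > length v\<close> the bit is appended; with this choice the
rules for equality, adjacency and colour hold for all \<open>i\<close> and \<open>v\<close>.\<close>

fun ins_bit :: "nat \<Rightarrow> bool \<Rightarrow> bool list \<Rightarrow> bool list" where
  "ins_bit 0 c v = c # v"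
| "ins_bit (Suc i) c [] = [c]"
| "ins_bit (Suc i) c (x # v) = x # ins_bit i c v"

lemma length_ins_bit [simp]: "length (ins_bit i c v) = Suc (length v)"
  by (induction i c v rule: ins_bit.induct) auto

lemma ins_bit_in_cube [simp]: "ins_bit i c v \<in> cube (Suc n) \<longleftrightarrow> v \<in> cube n"
  by (simp add: cube_def)

lemma red_ins_bit [simp]: "red (ins_bit i c v) \<longleftrightarrow> red v \<noteq> c"
  by (induction i c v rule: ins_bit.induct) auto

lemma ins_bit_neq_Nil [simp]: "ins_bit i c v \<noteq> []" "[] \<noteq> ins_bit i c v"
  using length_ins_bit[of i c v] by (auto simp del: length_ins_bit)

lemma ins_bit_eq_iff [simp]: "ins_bit i c u = ins_bit i d v \<longleftrightarrow> c = d \<and> u = v"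
proof (induction i c u arbitrary: v rule: ins_bit.induct)
  case (2 i c)
  then show ?case by (cases v) auto
next
  case (3 i c x u)
  then show ?case by (cases v) auto
qed auto

lemma adj_Nil [simp]: "\<not> adj [] v" "\<not> adj v []"
  by (cases v, simp, simp) (cases v, simp, simp)

lemma adj_ins_bit_iff [simp]: "adj (ins_bit i c u) (ins_bit i d v) \<longleftrightarrow> (if c = d then adj u v else u = v)"
proof (induction i c u arbitrary: v rule: ins_bit.induct)
  case (2 i c)
  then show ?case by (cases v; cases c; cases d) auto
next
  case (3 i c x u)
  then show ?case by (cases v; cases c; cases d) auto
qed auto

lemma ins_bit_surj: "w \<in> cube (Suc n) \<Longrightarrow> i \<le> n \<Longrightarrow> \<exists>u\<in>cube n. w = ins_bit i (w ! i) u"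
proof (induction i arbitrary: w n)
  case 0
  then show ?case by (cases w) (auto simp: cube_def)
next
  case (Suc i)
  then obtain m x w' where "n = Suc m" "w = x # w'" "w' \<in> cube (Suc m)"
    by (cases n; cases w) (auto simp: cube_def)
  moreover from this Suc obtain u where "u \<in> cube m" "w' = ins_bit i (w' ! i) u" by fastforce
  ultimately show ?case by (intro bexI[of _ "x # u"]) (auto simp: cube_def)
qed

lemma ins_bit_cases:
  assumes "w \<in> cube (Suc n)" "i \<le> n" "c \<noteq> d"
  obtains u where "u \<in> cube n" "w = ins_bit i c u" | u where "u \<in> cube n" "w = ins_bit i d u"
proof -
  from ins_bit_surj[OF assms(1,2)] obtain u e where "u \<in> cube n" "w = ins_bit i e u" by blast
  then show ?thesis using that assms(3) by (cases "e = c") auto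
qed

lemma separating_coordinate:
  assumes "a \<in> cube (Suc n)" "b \<in> cube (Suc n)" "a \<noteq> b"
  obtains i c d u v where
    "i \<le> n" "c \<noteq> d" "u \<in> cube n" "v \<in> cube n" "a = ins_bit i c u" "b = ins_bit i d v"
proof -
  obtain i where i: "i \<le> n" "a ! i \<noteq> b ! i"
    using assms nth_equalityI[of a b] by (auto simp: cube_def less_Suc_eq_le)
  from ins_bit_surj[OF assms(1) i(1)] obtain u c where u: "u \<in> cube n" "a = ins_bit i c u" "c = a ! i"
    by blast
  from ins_bit_surj[OF assms(2) i(1)] obtain v d where v: "v \<in> cube n" "b = ins_bit i d v" "d = b ! i"
    by blast
  have "c \<noteq> d" using u(3) v(3) i(2) by blast
  with u v i(1) show ?thesis using that[of i c d u v] by blast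
qed

lemma cube_Suc_minus:
  assumes "i \<le> n" "c \<noteq> d"
  shows "cube (Suc n) - (ins_bit i c ` A \<union> ins_bit i d ` B)
    = ins_bit i c ` (cube n - A) \<union> ins_bit i d ` (cube n - B)" (is "?L = ?R")
proof
  show "?L \<subseteq> ?R"
  proof
    fix w assume w: "w \<in> ?L"
    then have "w \<in> cube (Suc n)" by simp
    then show "w \<in> ?R"
      using assms by (cases rule: ins_bit_cases[of w n i c d]) (use w assms(2) in auto)
  qed
qed (use assms in auto)

lemma path_on_ins_bit: "path_on S a b \<Longrightarrow> path_on (ins_bit i c ` S) (ins_bit i c a) (ins_bit i c b)"
proof (induction rule: path_on.induct)
  case (single a)
  then show ?case by (simp add: path_on.single)
next
  case (step S b d a)
  moreover from step.hyps(3) have "ins_bit i c a \<notin> ins_bit i c ` S" by auto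
  ultimately show ?case
    using path_on.step[of "ins_bit i c ` S" "ins_bit i c b" "ins_bit i c d" "ins_bit i c a"] by simp
qed

lemma ins_bit_disjoint: "c \<noteq> d \<Longrightarrow> ins_bit i c ` S \<inter> ins_bit i d ` T = {}"
  by auto

lemma ins_bit_disjoint_same: "S \<inter> T = {} \<Longrightarrow> ins_bit i c ` S \<inter> ins_bit i c ` T = {}"
  by auto

text \<open>In the next lemmas \<open>A\<close> and \<open>B\<close> are the faults in the two halves, in terms of the smaller
cube. Vertices of either half carry the same name in the smaller cube as their twins, so that a
path arriving at \<open>x\<close> in one half continues from \<open>x\<close> in the other; but twins have different
colours in the large cube.\<close>

context
  fixes i n :: nat and c d :: bool and F A B
  assumes i: "i \<le> n" and cd: "c \<noteq> d" and F: "F = ins_bit i c ` A \<union> ins_bit i d ` B"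
begin

lemmas halves_disjoint =
  ins_bit_disjoint[OF cd] ins_bit_disjoint[OF cd[symmetric]] ins_bit_disjoint_same Int_Un_distrib Int_Un_distrib2

lemma join_ins_bit:
  assumes "path_on S a x" "path_on T x b"
  shows "path_on (ins_bit i c ` S \<union> ins_bit i d ` T) (ins_bit i c a) (ins_bit i d b)"
  using path_on_append[OF path_on_ins_bit[OF assms(1), of i c] _ path_on_ins_bit[OF assms(2), of i d]] cd
  by (simp add: ins_bit_disjoint)

lemma cross_once:
  assumes "path_on (cube n - A) a x" "path_on (cube n - B) x b"
  shows "path_on (cube (Suc n) - F) (ins_bit i c a) (ins_bit i d b)"
  unfolding F cube_Suc_minus[OF i cd]
  by (rule join_ins_bit[OF assms])

text \<open>The vertices \<open>x\<close> and \<open>y\<close> need not be adjacent: the gap between them may be a cut edge or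
the place of a removed vertex.\<close>

lemma detour:
  assumes "paths_on (cube n - A) a x y b" "path_on (cube n - B) x y"
  shows "path_on (cube (Suc n) - F) (ins_bit i c a) (ins_bit i c b)"
proof -
  from assms(1) obtain S T where S: "cube n - A = S \<union> T" "S \<inter> T = {}"
    "path_on S a x" "path_on T y b" by (auto simp: paths_on_def)
  have "path_on (ins_bit i c ` S \<union> ins_bit i d ` (cube n - B)) (ins_bit i c a) (ins_bit i d y)"
    by (rule join_ins_bit[OF S(3) assms(2)])
  from path_on_append[OF this _ path_on_ins_bit[OF S(4), of i c]]
  have "path_on (ins_bit i c ` S \<union> ins_bit i d ` (cube n - B) \<union> ins_bit i c ` T) (ins_bit i c a) (ins_bit i c b)"
    using S(2) cd[symmetric] by (simp add: halves_disjoint)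
  moreover have "ins_bit i c ` S \<union> ins_bit i d ` (cube n - B) \<union> ins_bit i c ` T = cube (Suc n) - F"
    unfolding F cube_Suc_minus[OF i cd] S(1) by auto
  ultimately show ?thesis by simp
qed

lemma cross_thrice:
  assumes "paths_on (cube n - A) a x y z" "paths_on (cube n - B) x y z b"
  shows "path_on (cube (Suc n) - F) (ins_bit i c a) (ins_bit i d b)"
proof -
  from assms(1) obtain S T where S: "cube n - A = S \<union> T" "S \<inter> T = {}"
    "path_on S a x" "path_on T y z" by (auto simp: paths_on_def)
  from assms(2) obtain U V where U: "cube n - B = U \<union> V" "U \<inter> V = {}"
    "path_on U x y" "path_on V z b" by (auto simp: paths_on_def)
  have 1: "path_on (ins_bit i c ` S \<union> ins_bit i d ` U) (ins_bit i c a) (ins_bit i d y)"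
    by (rule join_ins_bit[OF S(3) U(3)])
  have 2: "path_on (ins_bit i c ` T \<union> ins_bit i d ` V) (ins_bit i c y) (ins_bit i d b)"
    by (rule join_ins_bit[OF S(4) U(4)])
  have "path_on (ins_bit i c ` S \<union> ins_bit i d ` U \<union> (ins_bit i c ` T \<union> ins_bit i d ` V))
      (ins_bit i c a) (ins_bit i d b)"
    using S(2) U(2) by (intro path_on_append[OF 1 _ 2]) (simp_all add: halves_disjoint cd cd[symmetric])
  moreover have "ins_bit i c ` S \<union> ins_bit i d ` U \<union> (ins_bit i c ` T \<union> ins_bit i d ` V)
      = cube (Suc n) - F"
    unfolding F cube_Suc_minus[OF i cd] S(1) U(1) by auto
  ultimately show ?thesis by simp
qed

lemma one_path_per_half:
  assumes "path_on (cube n - A) a b" "path_on (cube n - B) a' b'"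
  shows "paths_on (cube (Suc n) - F) (ins_bit i c a) (ins_bit i c b) (ins_bit i d a') (ins_bit i d b')"
  unfolding F cube_Suc_minus[OF i cd]
  by (rule paths_onI[OF path_on_ins_bit[OF assms(1)] path_on_ins_bit[OF assms(2)]])
    (simp_all add: halves_disjoint)

lemma second_path_crosses:
  assumes "paths_on (cube n - A) a b p x" "path_on (cube n - B) x e"
  shows "paths_on (cube (Suc n) - F) (ins_bit i c a) (ins_bit i c b) (ins_bit i c p) (ins_bit i d e)"
proof -
  from assms(1) obtain S T where S: "cube n - A = S \<union> T" "S \<inter> T = {}"
    "path_on S a b" "path_on T p x" by (auto simp: paths_on_def)
  have 1: "path_on (ins_bit i c ` T \<union> ins_bit i d ` (cube n - B)) (ins_bit i c p) (ins_bit i d e)"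
    by (rule join_ins_bit[OF S(4) assms(2)])
  show ?thesis
    unfolding F cube_Suc_minus[OF i cd] S(1)
    by (rule paths_onI[OF path_on_ins_bit[OF S(3)] 1], blast)
      (use S(2) in \<open>simp add: halves_disjoint\<close>)
qed

lemma both_paths_cross:
  assumes "paths_on (cube n - A) a x b y" "paths_on (cube n - B) x p y e"
  shows "paths_on (cube (Suc n) - F) (ins_bit i c a) (ins_bit i d p) (ins_bit i c b) (ins_bit i d e)"
proof -
  from assms(1) obtain S T where S: "cube n - A = S \<union> T" "S \<inter> T = {}"
    "path_on S a x" "path_on T b y" by (auto simp: paths_on_def)
  from assms(2) obtain U V where U: "cube n - B = U \<union> V" "U \<inter> V = {}"
    "path_on U x p" "path_on V y e" by (auto simp: paths_on_def)
  have 1: "path_on (ins_bit i c ` S \<union> ins_bit i d ` U) (ins_bit i c a) (ins_bit i d p)"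
    by (rule join_ins_bit[OF S(3) U(3)])
  have 2: "path_on (ins_bit i c ` T \<union> ins_bit i d ` V) (ins_bit i c b) (ins_bit i d e)"
    by (rule join_ins_bit[OF S(4) U(4)])
  show ?thesis
    unfolding F cube_Suc_minus[OF i cd] S(1) U(1)
    by (rule paths_onI[OF 1 2], blast)
      (use S(2) U(2) in \<open>simp add: halves_disjoint\<close>)
qed

end

section \<open>Exhaustive search in small cubes\<close>

text \<open>The conditional makes the simplifier stop at the first witness, because it evaluates the
branches of a conditional only after its condition; a disjunction would be evaluated on both
sides.\<close>

fun any :: "('a \<Rightarrow> bool) \<Rightarrow> 'a list \<Rightarrow> bool" where
  "any P [] \<longleftrightarrow> False"
| "any P (x # xs) \<longleftrightarrow> (if P x then True else any P xs)"

lemma any_iff: "any P xs \<longleftrightarrow> (\<exists>x\<in>set xs. P x)"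
  by (induction xs) auto

text \<open>In all uses \<open>k\<close> is the length of \<open>V\<close>, so that the path ends exactly when every vertex of
\<open>V\<close> is used.\<close>

fun search :: "nat \<Rightarrow> bool list list \<Rightarrow> bool list \<Rightarrow> bool list \<Rightarrow> bool" where
  "search 0 V a b \<longleftrightarrow> a = b"
| "search (Suc k) V a b \<longleftrightarrow>
    any (\<lambda>v. if adj a v then search k (remove1 v V) v b else False) V"

fun search2 :: "nat \<Rightarrow> bool list list \<Rightarrow> bool list \<Rightarrow> bool list \<Rightarrow> bool list \<Rightarrow> bool list \<Rightarrow> bool" where
  "search2 0 V a b c d \<longleftrightarrow> False"
| "search2 (Suc k) V a b c d \<longleftrightarrow>
    (if a = b then (if c \<in> set V then search k (remove1 c V) c d else False)
     else any (\<lambda>v. if adj a v then search2 k (remove1 v V) v b c d else False) V)"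

lemma search_sound:
  "search k V a b \<Longrightarrow> length V = k \<Longrightarrow> distinct V \<Longrightarrow> a \<notin> set V \<Longrightarrow> path_on (insert a (set V)) a b"
proof (induction k arbitrary: V a)
  case 0
  then show ?case by (simp add: path_on.single)
next
  case (Suc k)
  then obtain v where v: "v \<in> set V" "adj a v" "search k (remove1 v V) v b"
    by (auto simp: any_iff split: if_splits)
  have "path_on (insert v (set (remove1 v V))) v b"
    using Suc.prems v by (intro Suc.IH) (auto simp: length_remove1)
  moreover have "insert v (set (remove1 v V)) = set V" using Suc.prems(3) v(1) by auto
  ultimately show ?case using path_on.step[of "set V" v b a] v(2) Suc.prems(4) by simp
qed

lemma search_complete:
  "path_on S a b \<Longrightarrow> distinct V \<Longrightarrow> set V = S - {a} \<Longrightarrow> search (length V) V a b"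
proof (induction arbitrary: V rule: path_on.induct)
  case (single a)
  then show ?case by simp
next
  case (step S b c a)
  have V: "set V = S" "b \<in> set V" using step path_on_ends by auto
  then obtain k where k: "length V = Suc k" by (cases V) auto
  have "search (length (remove1 b V)) (remove1 b V) b c"
    using step.prems V by (intro step.IH) auto
  then show ?case using V(2) k step.hyps(2) by (auto simp: any_iff length_remove1)
qed

lemma search2_sound:
  "search2 k V a b c d \<Longrightarrow> length V = k \<Longrightarrow> distinct V \<Longrightarrow> a \<notin> set V \<Longrightarrow>
    paths_on (insert a (set V)) a b c d"
proof (induction k arbitrary: V a)
  case 0
  then show ?case by simp
next
  case (Suc k)
  show ?case
  proof (cases "a = b")
    case True
    with Suc.prems have c: "c \<in> set V" "search k (remove1 c V) c d" by (auto split: if_splits)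
    have "path_on (insert c (set (remove1 c V))) c d"
      using Suc.prems c by (intro search_sound) (auto simp: length_remove1)
    moreover have "insert c (set (remove1 c V)) = set V" using Suc.prems(3) c(1) by auto
    ultimately show ?thesis
      using True Suc.prems(4) path_on.single[of a] by (intro paths_onI[of "{a}" a b "set V"]) auto
  next
    case False
    with Suc obtain v where v: "v \<in> set V" "adj a v" "search2 k (remove1 v V) v b c d"
      by (auto simp: any_iff split: if_splits)
    have "paths_on (insert v (set (remove1 v V))) v b c d"
      using Suc.prems v by (intro Suc.IH) (auto simp: length_remove1)
    moreover have "insert v (set (remove1 v V)) = set V" using Suc.prems(3) v(1) by auto
    ultimately show ?thesis using paths_on_step[of "set V" v b c d a] v(2) Suc.prems(4) by simp
  qed
qed

fun vertices :: "nat \<Rightarrow> bool list list" where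
  "vertices 0 = [[]]"
| "vertices (Suc n) = map (Cons False) (vertices n) @ map (Cons True) (vertices n)"

lemma set_vertices: "set (vertices n) = cube n"
  by (induction n) (auto simp: cube_def length_Suc_conv image_iff)

lemma distinct_vertices: "distinct (vertices n)"
  by (induction n) (auto simp: distinct_map)

definition remaining :: "nat \<Rightarrow> bool list list \<Rightarrow> bool list list" where
  "remaining n F = filter (\<lambda>v. v \<notin> set F) (vertices n)"

lemma remaining: "set (remaining n F) = cube n - set F" "distinct (remaining n F)"
  by (auto simp: remaining_def set_vertices distinct_vertices)

definition traceable :: "nat \<Rightarrow> bool list list \<Rightarrow> bool list \<Rightarrow> bool list \<Rightarrow> bool" where
  "traceable n F a b = (let V = remaining n (a # F) in search (length V) V a b)"

definition traceable2 ::
  "nat \<Rightarrow> bool list list \<Rightarrow> bool list \<Rightarrow> bool list \<Rightarrow> bool list \<Rightarrow> bool list \<Rightarrow> bool" where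
  "traceable2 n F a b c d = (let V = remaining n (a # F) in search2 (length V) V a b c d)"

lemma traceable_iff:
  assumes "a \<in> cube n - set F"
  shows "traceable n F a b \<longleftrightarrow> path_on (cube n - set F) a b"
proof -
  let ?V = "remaining n (a # F)"
  have V: "insert a (set ?V) = cube n - set F" "a \<notin> set ?V" "distinct ?V"
    using assms by (auto simp: remaining)
  have "path_on (cube n - set F) a b" if "search (length ?V) ?V a b"
    using search_sound[OF that refl V(3,2)] unfolding V(1) .
  moreover have "search (length ?V) ?V a b" if "path_on (cube n - set F) a b"
    by (rule search_complete[OF that V(3)]) (use V(1,2) in blast)
  ultimately show ?thesis unfolding traceable_def Let_def by blast
qed

lemma traceable2_imp:
  assumes "traceable2 n F a b c d" "a \<in> cube n - set F"
  shows "paths_on (cube n - set F) a b c d"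
proof -
  let ?V = "remaining n (a # F)"
  have V: "insert a (set ?V) = cube n - set F" "a \<notin> set ?V" "distinct ?V"
    using assms(2) by (auto simp: remaining)
  have "search2 (length ?V) ?V a b c d" using assms(1) by (simp add: traceable2_def Let_def)
  from search2_sound[OF this refl V(3,2)] show ?thesis unfolding V(1) .
qed

lemma red_code [code]: "red [] = True" "red (x # v) = (if x then \<not> red v else red v)"
  by auto

lemma list_all_vertices: "list_all P (vertices n) \<longleftrightarrow> (\<forall>v\<in>cube n. P v)"
  by (simp add: list_all_iff set_vertices)

lemma any_vertices: "any P (vertices n) \<longleftrightarrow> (\<exists>v\<in>cube n. P v)"
  by (simp add: any_iff set_vertices)

lemma guarded: "(if P then Q else True) \<longleftrightarrow> (P \<longrightarrow> Q)" "(if P then Q else False) \<longleftrightarrow> P \<and> Q"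
  by auto

lemmas over_cube = list_all_vertices any_vertices guarded

lemma cube3_two_paths:
  assumes "r \<in> cube 3" "s \<in> cube 3" "g \<in> cube 3" "h \<in> cube 3"
    "r \<noteq> s" "g \<noteq> h" "red r = red s" "red g = red h" "red g \<noteq> red r"
  shows "paths_on (cube 3) r g s h"
proof -
  \<comment> \<open>The conditions on the bound variables, even the trivial one on the first, keep the
    simplifier from unfolding the bodies before the variables have values.\<close>
  have "list_all (\<lambda>r. if length r = 3 then
      list_all (\<lambda>s. if r \<noteq> s \<and> red r = red s then
        list_all (\<lambda>g. if red g \<noteq> red r then
          list_all (\<lambda>h. if g \<noteq> h \<and> red g = red h then
            traceable2 3 [] r g s h
          else True) (vertices 3) else True) (vertices 3) else True) (vertices 3) else True) (vertices 3)"
    by code_simp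
  then have "traceable2 3 [] r g s h"
    using assms unfolding over_cube by (simp add: cube_def)
  then show ?thesis using traceable2_imp[of 3 "[]"] assms by simp
qed

text \<open>In \<open>Q\<^sub>3\<close> not all four ends of a neutral and a charged path can be prescribed, but three
can.\<close>

lemma cube3_minus_one_weak:
  assumes "s \<in> cube 3" "r \<in> cube 3" "x \<in> cube 3" "a \<in> cube 3"
    "s \<noteq> r" "x \<noteq> a" "red s = red r" "red x = red a" "red x \<noteq> red r"
  shows "\<exists>c\<in>cube 3. red c = red a \<and> c \<noteq> a \<and> paths_on (cube 3 - {s}) r x a c"
proof -
  have *: "list_all (\<lambda>s. if length s = 3 then
      list_all (\<lambda>r. if r \<noteq> s \<and> red r = red s then
        list_all (\<lambda>x. if red x \<noteq> red r then
          list_all (\<lambda>a. if a \<noteq> x \<and> red a = red x then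
            any (\<lambda>c. if red c = red a \<and> c \<noteq> a \<and> c \<noteq> x then traceable2 3 [s] r x a c else False)
              (vertices 3)
          else True) (vertices 3) else True) (vertices 3) else True) (vertices 3) else True) (vertices 3)"
    by code_simp
  have "\<exists>c\<in>cube 3. (red c = red a \<and> c \<noteq> a \<and> c \<noteq> x) \<and> traceable2 3 [s] r x a c"
    by (rule *[unfolded over_cube, rule_format, of s r x a]) (use assms in \<open>simp_all add: cube_def\<close>)
  then obtain c where "c \<in> cube 3" "red c = red a" "c \<noteq> a" "traceable2 3 [s] r x a c"
    by blast
  moreover from this have "paths_on (cube 3 - {s}) r x a c"
    using traceable2_imp[of 3 "[s]" r x a c] assms by simp
  ultimately show ?thesis by blast
qed

text \<open>In \<open>Q\<^sub>3\<close> without \<open>r\<close> and \<open>g\<close>, six vertices remain, and not every pair of ends of different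
colours is joined by a Hamiltonian path. Two weaker facts hold: one end may be prescribed, and
adjacent ends may be prescribed if they avoid one exceptional vertex \<open>w\<close> (if \<open>r\<close> and \<open>g\<close> are
adjacent, \<open>w\<close> is an end of the middle rung of the ladder that remains).\<close>

lemma cube3_minus_two_weak:
  assumes "r \<in> cube 3" "g \<in> cube 3" "red r \<noteq> red g"
  shows "\<forall>v\<in>cube 3. red v = red g \<and> v \<noteq> g \<longrightarrow>
      (\<exists>x\<in>cube 3. red x \<noteq> red v \<and> path_on (cube 3 - {r, g}) v x)" (is ?A)
    and "\<exists>w. \<forall>x\<in>cube 3 - {r, g, w}. \<forall>y\<in>cube 3 - {r, g, w}. adj x y \<longrightarrow>
      path_on (cube 3 - {r, g}) x y" (is ?B)
proof -
  have "list_all (\<lambda>r. if length r = 3 then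
      list_all (\<lambda>g. if red g \<noteq> red r then
        list_all (\<lambda>v. if red v = red g \<and> v \<noteq> g then
          any (\<lambda>x. if red x \<noteq> red v then traceable 3 [r, g] v x else False) (vertices 3)
        else True) (vertices 3) else True) (vertices 3) else True) (vertices 3)"
    by code_simp
  then have "\<forall>v\<in>cube 3. red v = red g \<and> v \<noteq> g \<longrightarrow>
      (\<exists>x\<in>cube 3. red x \<noteq> red v \<and> traceable 3 [r, g] v x)"
    using assms unfolding over_cube by (auto simp: cube_def)
  moreover have "traceable 3 [r, g] v x \<longleftrightarrow> path_on (cube 3 - {r, g}) v x"
    if "v \<in> cube 3" "red v = red g \<and> v \<noteq> g" for v x
    using assms that traceable_iff[of v 3 "[r, g]"] by auto
  ultimately show ?A by auto
next
  have *: "list_all (\<lambda>r. if length r = 3 then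
      list_all (\<lambda>g. if red g \<noteq> red r then
        any (\<lambda>w. if length w = 3 then
          list_all (\<lambda>x. if x \<notin> set [r, g, w] then
            list_all (\<lambda>y. if adj x y \<and> y \<notin> set [r, g, w] then
              traceable 3 [r, g] x y
            else True) (vertices 3) else True) (vertices 3) else False) (vertices 3)
      else True) (vertices 3) else True) (vertices 3)"
    by code_simp
  have "\<exists>w\<in>cube 3. length w = 3 \<and> (\<forall>x\<in>cube 3. x \<notin> set [r, g, w] \<longrightarrow>
      (\<forall>y\<in>cube 3. adj x y \<and> y \<notin> set [r, g, w] \<longrightarrow> traceable 3 [r, g] x y))"
    by (rule *[unfolded over_cube, rule_format, of r g]) (use assms in \<open>simp_all add: cube_def\<close>)
  then obtain w where "\<forall>x\<in>cube 3 - {r, g, w}. \<forall>y\<in>cube 3 - {r, g, w}. adj x y \<longrightarrow>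
      traceable 3 [r, g] x y"
    by auto
  moreover have "traceable 3 [r, g] x y \<longleftrightarrow> path_on (cube 3 - {r, g}) x y"
    if "x \<in> cube 3 - {r, g, w}" for x y
    using that traceable_iff[of x 3 "[r, g]" y] by auto
  ultimately show ?B by blast
qed

text \<open>The forced edges that rule out a path are listed at the beginning.\<close>

lemma cube4_counterexample:
  "\<not> path_on (cube 4 - {[False,False,True,True], [False,True,False,True], [True,False,False,False],
    [True,True,True,False]}) [False,False,False,False] [True,False,True,True]"
proof -
  have "\<not> traceable 4 [[False,False,True,True], [False,True,False,True], [True,False,False,False],
    [True,True,True,False]] [False,False,False,False] [True,False,True,True]"
    by code_simp
  then show ?thesis by (subst (asm) traceable_iff) (auto simp: cube_def)
qed

text \<open>The only remaining neighbour of the start 000 is the other end 001, although two more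
vertices are to be covered.\<close>

lemma cube3_counterexample:
  "\<not> path_on (cube 3 - {[False,True,True], [True,False,True], [False,True,False],
    [True,False,False]}) [False,False,False] [False,False,True]"
proof -
  have "\<not> traceable 3 [[False,True,True], [True,False,True], [False,True,False],
    [True,False,False]] [False,False,False] [False,False,True]"
    by code_simp
  then show ?thesis by (subst (asm) traceable_iff) (auto simp: cube_def)
qed

section \<open>Path coverings with at most two deleted vertices\<close>

text \<open>A coordinate in which the ends differ separates them; the path crosses between the halves
once.\<close>

lemma cube_one_path:
  assumes "0 < n" "a \<in> cube n" "b \<in> cube n" "red a \<noteq> red b"
  shows "path_on (cube n) a b"
  using assms
proof (induction n arbitrary: a b)
  case (Suc n)
  have "a \<noteq> b" using Suc.prems(4) by auto
  then obtain i c d u v where i: "i \<le> n" and cd: "c \<noteq> d" and uv: "u \<in> cube n" "v \<in> cube n"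
    and ab: "a = ins_bit i c u" "b = ins_bit i d v"
    using separating_coordinate Suc.prems(2,3) by metis
  have col: "red u = red v" using Suc.prems(4) cd by (auto simp: ab)
  have "\<exists>x. path_on (cube n) u x \<and> path_on (cube n) x v"
  proof (cases "n = 0")
    case True
    then have "cube n = {u}" "v = u" using uv by (auto simp: cube_def)
    then show ?thesis using path_on.single[of u] by auto
  next
    case False
    then obtain x where "x \<in> cube n" "red x = (\<not> red u)"
      using ex_vertex_avoiding[of "[]" n "\<not> red u"] by auto
    then show ?thesis using Suc.IH[of u x] Suc.IH[of x v] uv col False by auto
  qed
  then obtain x where "path_on (cube n) u x" "path_on (cube n) x v" by blast
  then show ?case using cross_once[OF i cd, of "{}" "{}" "{}" u x v] by (simp add: ab)
qed simp

text \<open>The ends are separated; the half with the deleted vertex is left at an arbitrary vertex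
\<open>x\<close> of the colour of the ends.\<close>

lemma cube_minus_one_path:
  assumes "2 \<le> n" "s \<in> cube n" "a \<in> cube n" "b \<in> cube n"
    "a \<noteq> b" "red a = red b" "red s \<noteq> red a"
  shows "path_on (cube n - {s}) a b"
  using assms
proof (induction n arbitrary: s a b)
  case (Suc n)
  have half: "path_on (cube (Suc n) - {ins_bit i c w}) (ins_bit i c u) (ins_bit i d v)"
    if i: "i \<le> n" and cd: "c \<noteq> d" and uvw: "u \<in> cube n" "v \<in> cube n" "w \<in> cube n"
      and col: "red w \<noteq> red u" "red v \<noteq> red u" for i c d u v w
  proof -
    have "\<exists>x\<in>cube n. red x = red u \<and> path_on (cube n - {w}) u x"
    \<comment> \<open>If the halves are edges, the path in the half with the deleted vertex is a single
      vertex.\<close>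
    proof (cases "n = 1")
      case True
      then have "cube n - {w} = {u}" using uvw col(1) by (auto simp: cube_def length_Suc_conv)
      then show ?thesis using path_on.single[of u] uvw(1) by auto
    next
      case False
      then have n: "2 \<le> n" using Suc.prems(1) by simp
      then have "2 ^ 1 \<le> (2::nat) ^ (n - 1)" by (intro power_increasing) auto
      then obtain x where "x \<in> cube n" "red x = red u" "x \<notin> {u}"
        using ex_vertex_avoiding[of "[u]" n "red u"] n by auto
      then show ?thesis using Suc.IH[of w u x] n uvw col by auto
    qed
    then obtain x where x: "x \<in> cube n" "red x = red u" "path_on (cube n - {w}) u x" by blast
    have "path_on (cube n - {}) x v" using x col(2) uvw Suc.prems(1) by (simp add: cube_one_path)
    then show ?thesis using cross_once[OF i cd, of "{ins_bit i c w}" "{w}" "{}" u x v] x(3) by simp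
  qed
  obtain i c d u v where i: "i \<le> n" and cd: "c \<noteq> d" and uv: "u \<in> cube n" "v \<in> cube n"
    and ab: "a = ins_bit i c u" "b = ins_bit i d v"
    using separating_coordinate Suc.prems(3-5) by metis
  show ?case
  proof (cases rule: ins_bit_cases[OF Suc.prems(2) i cd])
    case (1 w)
    then show ?thesis using half[OF i cd uv, of w] Suc.prems(6,7) cd unfolding ab by auto
  next
    case (2 w)
    then have "path_on (cube (Suc n) - {s}) b a"
      using half[OF i cd[symmetric] uv(2,1), of w] Suc.prems(6,7) cd unfolding ab by auto
    then show ?thesis by (rule path_on_rev)
  qed
qed simp

text \<open>The starts \<open>r\<close> and \<open>s\<close> of equal colour are separated. Depending on the halves of \<open>g\<close> and
\<open>h\<close>, no path, one path or both paths have to cross.\<close>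

lemma cube_two_paths:
  assumes "3 \<le> n" "r \<in> cube n" "s \<in> cube n" "g \<in> cube n" "h \<in> cube n"
    "r \<noteq> s" "g \<noteq> h" "red r = red s" "red g = red h" "red g \<noteq> red r"
  shows "paths_on (cube n) r g s h"
  using assms
proof (induction n arbitrary: r s g h rule: nat_induct_at_least)
  case base
  then show ?case by (intro cube3_two_paths)
next
  case (Suc n)
  have four: "2 ^ 2 \<le> (2::nat) ^ (n - 1)" using Suc.hyps by (intro power_increasing) auto
  obtain i c d r' s' where i: "i \<le> n" and cd: "c \<noteq> d" and rs': "r' \<in> cube n" "s' \<in> cube n"
    and rs: "r = ins_bit i c r'" "s = ins_bit i d s'"
    using separating_coordinate Suc.prems(1,2,5) by metis
  have col: "red s' \<noteq> red r'" using Suc.prems(7) cd by (auto simp: rs)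
  show ?case
  proof (cases rule: ins_bit_cases[OF Suc.prems(3) i cd]; cases rule: ins_bit_cases[OF Suc.prems(4) i cd])
    fix g' h' assume g': "g' \<in> cube n" "g = ins_bit i c g'"
      and h': "h' \<in> cube n" "h = ins_bit i c h'"
    have gh: "g' \<noteq> h'" "red g' = red h'" "red g' \<noteq> red r'"
      using Suc.prems(6,8,9) by (auto simp: g' h' rs)
    obtain y where y: "y \<in> cube n" "red y = red r'" "y \<notin> {r'}"
      using ex_vertex_avoiding[of "[r']" n "red r'"] four Suc.hyps by auto
    have "paths_on (cube n) r' g' h' y"
      using y gh g' h' rs' by (intro paths_on_rev2[OF Suc.IH]) auto
    moreover have "path_on (cube n) y s'" using y col rs' Suc.hyps by (intro cube_one_path) auto
    ultimately have "paths_on (cube (Suc n)) r g h s"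
      using second_path_crosses[OF i cd, of "{}" "{}" "{}" r' g' h' y s']
      by (simp add: rs g' h')
    then show ?thesis by (rule paths_on_rev2)
  next
    fix g' h' assume g': "g' \<in> cube n" "g = ins_bit i c g'"
      and h': "h' \<in> cube n" "h = ins_bit i d h'"
    have "red g' \<noteq> red r'" "red h' \<noteq> red s'" using Suc.prems(7-9) cd by (auto simp: g' h' rs)
    then have "path_on (cube n) r' g'" "path_on (cube n) s' h'"
      using rs' g' h' Suc.hyps by (auto intro: cube_one_path)
    then show ?thesis
      using one_path_per_half[OF i cd, of "{}" "{}" "{}" r' g' s' h'] by (simp add: rs g' h')
  next
    fix g' h' assume g': "g' \<in> cube n" "g = ins_bit i d g'"
      and h': "h' \<in> cube n" "h = ins_bit i c h'"
    have gh: "red g' = red r'" "red h' = red s'" using Suc.prems(7-9) cd by (auto simp: g' h' rs)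
    obtain x where x: "x \<in> cube n" "red x = red s'" "x \<notin> {h', s'}"
      using ex_vertex_avoiding[of "[h', s']" n "red s'"] four Suc.hyps by auto
    obtain y where y: "y \<in> cube n" "red y = red r'" "y \<notin> {r', g'}"
      using ex_vertex_avoiding[of "[r', g']" n "red r'"] four Suc.hyps by auto
    have "paths_on (cube n) r' x h' y" "paths_on (cube n) x g' y s'"
      using x y gh col g' h' rs' by (auto intro!: paths_on_rev2[OF Suc.IH])
    then have "paths_on (cube (Suc n)) r g h s"
      using both_paths_cross[OF i cd, of "{}" "{}" "{}" r' x h' y g' s']
      by (simp add: rs g' h')
    then show ?thesis by (rule paths_on_rev2)
  next
    fix g' h' assume g': "g' \<in> cube n" "g = ins_bit i d g'"
      and h': "h' \<in> cube n" "h = ins_bit i d h'"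
    have gh: "g' \<noteq> h'" "red g' = red h'" "red g' \<noteq> red s'"
      using Suc.prems(6-9) cd by (auto simp: g' h' rs)
    obtain y where y: "y \<in> cube n" "red y = red s'" "y \<notin> {s'}"
      using ex_vertex_avoiding[of "[s']" n "red s'"] four Suc.hyps by auto
    have "paths_on (cube n) s' h' g' y"
      using y gh g' h' rs' by (intro paths_on_rev2[OF Suc.IH]) auto
    moreover have "path_on (cube n) y r'" using y col rs' Suc.hyps by (intro cube_one_path) auto
    ultimately have "paths_on (cube (Suc n)) s h g r"
      using second_path_crosses[OF i cd[symmetric], of "{}" "{}" "{}" s' h' g' y r']
      by (simp add: rs g' h')
    then show ?thesis by (rule paths_on_swap[OF paths_on_rev2])
  qed
qed

text \<open>The ends \<open>a\<close>, \<open>b\<close> of the charged path are separated, and \<open>s\<close> may be assumed to lie in the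
half of \<open>a\<close>. The charged path then has to cross, and where it does is free. So the hypothesis on
the smaller cube is needed only for some fourth end, not for a prescribed one.\<close>

lemma cube_minus_one_two_paths_step:
  assumes n: "3 \<le> n"
    and weak: "\<And>s r x a. s \<in> cube n \<Longrightarrow> r \<in> cube n \<Longrightarrow> x \<in> cube n \<Longrightarrow> a \<in> cube n \<Longrightarrow>
      s \<noteq> r \<Longrightarrow> x \<noteq> a \<Longrightarrow> red s = red r \<Longrightarrow> red x = red a \<Longrightarrow> red x \<noteq> red r \<Longrightarrow>
      \<exists>b\<in>cube n. red b = red a \<and> b \<noteq> a \<and> paths_on (cube n - {s}) r x a b"
    and verts: "s \<in> cube (Suc n)" "r \<in> cube (Suc n)" "x \<in> cube (Suc n)" "a \<in> cube (Suc n)"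
      "b \<in> cube (Suc n)"
    and neq: "s \<noteq> r" "x \<noteq> a" "x \<noteq> b" "a \<noteq> b"
    and col: "red s = red r" "red x = red a" "red a = red b" "red x \<noteq> red r"
  shows "paths_on (cube (Suc n) - {s}) r x a b"
proof -
  have four: "2 ^ 2 \<le> (2::nat) ^ (n - 1)" using n by (intro power_increasing) auto
  have half: "paths_on (cube (Suc n) - {s}) r x a b"
    if i: "i \<le> n" and cd: "c \<noteq> d" and s': "s' \<in> cube n" "s = ins_bit i c s'"
      and a': "a' \<in> cube n" "a = ins_bit i c a'" and b': "b' \<in> cube n" "b = ins_bit i d b'"
      and neq: "x \<noteq> a" "x \<noteq> b" and col: "red a = red b" "red x = red a"
    for i c d s' a' b' a b
  proof -
    have ab: "red b' \<noteq> red a'" "red s' \<noteq> red a'"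
      using col \<open>red s = red r\<close> \<open>red x \<noteq> red r\<close> cd by (auto simp: a' b' s')
    show ?thesis
    proof (cases rule: ins_bit_cases[OF verts(2) i cd]; cases rule: ins_bit_cases[OF verts(3) i cd])
      fix r' x' assume r': "r' \<in> cube n" "r = ins_bit i c r'"
        and x': "x' \<in> cube n" "x = ins_bit i c x'"
      obtain z where z: "z \<in> cube n" "red z = red a'" "paths_on (cube n - {s'}) r' x' a' z"
        using weak[of s' r' x' a'] s' r' x' a' \<open>s \<noteq> r\<close> \<open>red s = red r\<close> \<open>red x \<noteq> red r\<close> neq col by auto
      have "path_on (cube n - {}) z b'" using z ab b' n by (simp add: cube_one_path)
      from second_path_crosses[OF i cd _ z(3) this] show ?thesis
        by (simp add: r' x' a' b' s')
    next
      fix r' x' assume r': "r' \<in> cube n" "r = ins_bit i c r'"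
        and x': "x' \<in> cube n" "x = ins_bit i d x'"
      \<comment> \<open>Both paths cross, at \<open>y\<close> and at \<open>z\<close>.\<close>
      obtain y where y: "y \<in> cube n" "red y = red a'" "y \<notin> set [a']"
        using ex_vertex_avoiding[of "[a']" n "red a'"] four n by auto
      obtain z where z: "z \<in> cube n" "red z = red a'" "paths_on (cube n - {s'}) r' y a' z"
        using weak[of s' r' y a'] s' r' y a' \<open>s \<noteq> r\<close> \<open>red s = red r\<close> ab by auto
      have "y \<noteq> z" using paths_on_ends[OF z(3)] by simp
      then have "paths_on (cube n - {}) y x' z b'"
        using y z ab x' b' n neq col by (auto intro!: cube_two_paths)
      from both_paths_cross[OF i cd _ z(3) this] show ?thesis
        by (simp add: r' x' a' b' s')
    next
      fix r' x' assume r': "r' \<in> cube n" "r = ins_bit i d r'"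
        and x': "x' \<in> cube n" "x = ins_bit i c x'"
      have r_col: "red r' = red a'" using \<open>red s = red r\<close> ab cd by (auto simp: r' s')
      have x_col: "red x' = red a'" "x' \<noteq> a'" using col neq by (auto simp: x' a')
      \<comment> \<open>The half of \<open>a\<close> is covered by a path from \<open>a\<close> to \<open>x\<close>; after cutting an edge of it,
        its two parts are continued to \<open>b\<close> and to \<open>r\<close> in the other half.\<close>
      have top: "path_on (cube n - {s'}) a' x'"
        using s' a' x' ab x_col n by (intro cube_minus_one_path) auto
      have "length [r', b'] < card {v \<in> cube n - {s'}. red v \<noteq> red a'}"
        using card_colour_class_minus[of "{s'}" n "\<not> red a'"] four n by auto
      from path_on_cut_edge[OF top this] obtain p q where
        pq: "paths_on (cube n - {s'}) a' p q x'" "adj p q" "red p = red a'"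
          "p \<notin> set [r', b']" "q \<notin> set [r', b']" .
      have "p \<in> cube n" "q \<in> cube n" using paths_on_ends[OF pq(1)] by auto
      moreover have "red q \<noteq> red a'" using adj_red[OF pq(2)] pq(3) by auto
      ultimately have "paths_on (cube n - {}) p b' q r'"
        using pq r' b' ab r_col n by (auto intro!: paths_on_rev2[OF cube_two_paths])
      from both_paths_cross[OF i cd _ paths_on_rev2[OF pq(1)] this]
      have "paths_on (cube (Suc n) - {s}) a b x r" by (simp add: r' x' a' b' s')
      then show ?thesis by (rule paths_on_rev1[OF paths_on_swap])
    next
      fix r' x' assume r': "r' \<in> cube n" "r = ins_bit i d r'"
        and x': "x' \<in> cube n" "x = ins_bit i d x'"
      have r_col: "red r' = red a'" using \<open>red s = red r\<close> ab cd by (auto simp: r' s')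
      have x_col: "red x' = red b'" "x' \<noteq> b'" using col neq by (auto simp: x' b')
      obtain z where z: "z \<in> cube n" "red z = red a'" "z \<notin> set [a', r']"
        using ex_vertex_avoiding[of "[a', r']" n "red a'"] four n by auto
      have "paths_on (cube n - {}) r' x' b' z"
        using z r' x' b' r_col x_col ab n by (auto intro!: paths_on_rev2[OF cube_two_paths])
      moreover have "path_on (cube n - {s'}) z a'"
        using z s' a' ab n by (intro cube_minus_one_path) auto
      ultimately have "paths_on (cube (Suc n) - {s}) r x b a"
        using second_path_crosses[OF i cd[symmetric], of "{s}" "{}" "{s'}" r' x' b' z a']
        by (simp add: r' x' a' b' s')
      then show ?thesis by (rule paths_on_rev2)
    qed
  qed
  obtain i c d a' b' where i: "i \<le> n" and cd: "c \<noteq> d" and a': "a' \<in> cube n" "a = ins_bit i c a'"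
    and b': "b' \<in> cube n" "b = ins_bit i d b'"
    using separating_coordinate verts(4,5) neq(4) by metis
  show ?thesis
  proof (cases rule: ins_bit_cases[OF verts(1) i cd])
    case (1 s')
    then show ?thesis using half[OF i cd _ _ a' b'] neq col by blast
  next
    case (2 s')
    then have "paths_on (cube (Suc n) - {s}) r x b a"
      using half[OF i cd[symmetric] _ _ b' a'] neq col by metis
    then show ?thesis by (rule paths_on_rev2)
  qed
qed

lemma cube_minus_one_two_paths:
  assumes "4 \<le> n" "s \<in> cube n" "r \<in> cube n" "x \<in> cube n" "a \<in> cube n" "b \<in> cube n"
    "s \<noteq> r" "x \<noteq> a" "x \<noteq> b" "a \<noteq> b"
    "red s = red r" "red x = red a" "red a = red b" "red x \<noteq> red r"
  shows "paths_on (cube n - {s}) r x a b"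
  using assms
proof (induction n arbitrary: s r x a b rule: nat_induct_at_least)
  case base
  have "paths_on (cube (Suc 3) - {s}) r x a b"
    using base cube3_minus_one_weak by (intro cube_minus_one_two_paths_step) (auto simp: eval_nat_numeral)
  then show ?case by (simp add: eval_nat_numeral)
next
  case (Suc n)
  have "2 ^ 2 \<le> (2::nat) ^ (n - 1)" using Suc.hyps by (intro power_increasing) auto
  then have "2 < (2::nat) ^ (n - 1)" by simp
  then have "\<exists>b\<in>cube n. red b = red a \<and> b \<noteq> a \<and> paths_on (cube n - {s}) r x a b"
    if "s \<in> cube n" "r \<in> cube n" "x \<in> cube n" "a \<in> cube n"
      "s \<noteq> r" "x \<noteq> a" "red s = red r" "red x = red a" "red x \<noteq> red r" for s r x a
    using that Suc.IH[of s r x a] Suc.hyps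
      ex_vertex_avoiding[of "[x, a]" n "red a" "\<exists>b\<in>cube n. red b = red a \<and> b \<noteq> a \<and> b \<noteq> x"]
    by fastforce
  then show ?case using Suc.prems Suc.hyps by (intro cube_minus_one_two_paths_step) auto
qed

text \<open>The deleted vertex \<open>p\<close> is separated from the end \<open>r\<close> of its colour. If \<open>q\<close> is on the side
of \<open>r\<close>, then each half has one deleted vertex, and the previous lemmas suffice. Otherwise the
half of \<open>r\<close> is complete: either \<open>g\<close> is in the other half and only one end of a path there is
prescribed, or \<open>g\<close> is in the complete half and a detour from a path there leaves the choice of a
cut edge. Hence the two weak hypotheses are enough.\<close>

lemma cube_minus_two_path_step:
  assumes n: "3 \<le> n"
    and ends: "\<And>p q v. p \<in> cube n \<Longrightarrow> q \<in> cube n \<Longrightarrow> red p \<noteq> red q \<Longrightarrow> v \<in> cube n \<Longrightarrow>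
      red v = red q \<Longrightarrow> v \<noteq> q \<Longrightarrow> \<exists>x\<in>cube n. red x \<noteq> red v \<and> path_on (cube n - {p, q}) v x"
    and edges: "\<And>p q. p \<in> cube n \<Longrightarrow> q \<in> cube n \<Longrightarrow> red p \<noteq> red q \<Longrightarrow>
      \<exists>w. \<forall>x\<in>cube n - {p, q, w}. \<forall>y\<in>cube n - {p, q, w}. adj x y \<longrightarrow> path_on (cube n - {p, q}) x y"
    and verts: "p \<in> cube (Suc n)" "q \<in> cube (Suc n)" "r \<in> cube (Suc n)" "g \<in> cube (Suc n)"
    and neq: "p \<noteq> r" "q \<noteq> g"
    and col: "red p = red r" "red q = red g" "red r \<noteq> red g"
  shows "path_on (cube (Suc n) - {p, q}) r g"
proof -
  have four: "2 ^ 2 \<le> (2::nat) ^ (n - 1)" using n by (intro power_increasing) auto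
  obtain i c d r' p' where i: "i \<le> n" and cd: "c \<noteq> d" and r': "r' \<in> cube n" "r = ins_bit i c r'"
    and p': "p' \<in> cube n" "p = ins_bit i d p'"
    using separating_coordinate verts(1,3) neq(1) by metis
  have rp: "red p' \<noteq> red r'" using col(1) cd by (auto simp: r' p')
  show ?thesis
  proof (cases rule: ins_bit_cases[OF verts(2) i cd]; cases rule: ins_bit_cases[OF verts(4) i cd])
    fix q' g' assume q': "q' \<in> cube n" "q = ins_bit i c q'"
      and g': "g' \<in> cube n" "g = ins_bit i c g'"
    have gq: "red g' = red q'" "g' \<noteq> q'" "red g' \<noteq> red r'" using col neq by (auto simp: g' q' r')
    then have "path_on (cube n) r' g'" using r' g' n by (intro cube_one_path) auto
    then obtain x y where xy: "paths_on (cube n - {q'}) r' x y g'" "adj x q'" "adj q' y"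
      using path_on_remove_vertex[of "cube n" r' g' q'] gq q'(1) by metis
    have "path_on (cube n - {p'}) x y"
      using paths_on_ends[OF xy(1)] adj_red[OF xy(2)] adj_red[OF xy(3)] rp gq p' n
      by (intro cube_minus_one_path) auto
    from detour[OF i cd _ xy(1) this] show ?thesis by (simp add: p' q' r' g' insert_commute)
  next
    fix q' g' assume q': "q' \<in> cube n" "q = ins_bit i c q'"
      and g': "g' \<in> cube n" "g = ins_bit i d g'"
    have gq: "red g' = red r'" "red q' \<noteq> red r'" using col cd by (auto simp: g' q' r')
    obtain x where x: "x \<in> cube n" "red x = red r'" "x \<notin> set [r', g']"
      using ex_vertex_avoiding[of "[r', g']" n "red r'"] four n by auto
    have "path_on (cube n - {q'}) r' x" "path_on (cube n - {p'}) x g'"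
      using x q' r' g' p' gq rp n by (auto intro!: cube_minus_one_path)
    from cross_once[OF i cd _ this] show ?thesis by (simp add: p' q' r' g' insert_commute)
  next
    fix q' g' assume q': "q' \<in> cube n" "q = ins_bit i d q'"
      and g': "g' \<in> cube n" "g = ins_bit i c g'"
    have pq: "red p' \<noteq> red q'" "red r' \<noteq> red g'" using col by (auto simp: g' q' r' p')
    then have top: "path_on (cube n) r' g'" using r' g' n by (intro cube_one_path) auto
    obtain w where w: "\<And>x y. x \<in> cube n - {p', q', w} \<Longrightarrow> y \<in> cube n - {p', q', w} \<Longrightarrow> adj x y \<Longrightarrow>
        path_on (cube n - {p', q'}) x y"
      using edges[OF p'(1) q'(1) pq(1)] by blast
    have "length [p', q', w] < card {v \<in> cube n. red v \<noteq> red r'}"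
      using card_colour_class_minus[of "{}" n "\<not> red r'"] four n by auto
    from path_on_cut_edge[OF top this] obtain x y where
      xy: "paths_on (cube n) r' x y g'" "adj x y" "x \<notin> set [p', q', w]" "y \<notin> set [p', q', w]" .
    have "path_on (cube n - {p', q'}) x y"
      using w xy paths_on_ends[OF xy(1)] by auto
    then show ?thesis
      using detour[OF i cd, of "{p, q}" "{}" "{p', q'}" r' x y g'] xy(1) by (simp add: p' q' r' g')
  next
    fix q' g' assume q': "q' \<in> cube n" "q = ins_bit i d q'"
      and g': "g' \<in> cube n" "g = ins_bit i d g'"
    have pq: "red p' \<noteq> red q'" "red g' = red q'" "g' \<noteq> q'" "red g' = red r'"
      using col neq cd by (auto simp: g' q' r' p')
    obtain x where x: "x \<in> cube n" "red x \<noteq> red g'" "path_on (cube n - {p', q'}) g' x"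
      using ends[OF p'(1) q'(1) pq(1) g'(1) pq(2,3)] by blast
    have "path_on (cube n - {}) x r'" using x pq r' n by (simp add: cube_one_path)
    from cross_once[OF i cd[symmetric] _ x(3) this] have "path_on (cube (Suc n) - {p, q}) g r"
      by (simp add: p' q' r' g')
    then show ?thesis by (rule path_on_rev)
  qed
qed

lemma cube_minus_two_path:
  assumes "4 \<le> n" "p \<in> cube n" "q \<in> cube n" "r \<in> cube n" "g \<in> cube n"
    "p \<noteq> r" "q \<noteq> g" "red p = red r" "red q = red g" "red r \<noteq> red g"
  shows "path_on (cube n - {p, q}) r g"
  using assms
proof (induction n arbitrary: p q r g rule: nat_induct_at_least)
  case base
  have "path_on (cube (Suc 3) - {p, q}) r g"
    using base cube3_minus_two_weak by (intro cube_minus_two_path_step) (auto simp: eval_nat_numeral)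
  then show ?case by (simp add: eval_nat_numeral)
next
  case (Suc n)
  have n: "2 ^ 2 \<le> (2::nat) ^ (n - 1)" using Suc.hyps by (intro power_increasing) auto
  show ?case
  proof (rule cube_minus_two_path_step)
    fix p q v assume pqv: "p \<in> cube n" "q \<in> cube n" "red p \<noteq> red q" "v \<in> cube n" "red v = red q" "v \<noteq> q"
    obtain x where "x \<in> cube n" "red x = red p" "x \<notin> set [p]"
      using ex_vertex_avoiding[of "[p]" n "red p"] n Suc.hyps by auto
    then show "\<exists>x\<in>cube n. red x \<noteq> red v \<and> path_on (cube n - {p, q}) v x"
      using Suc.IH[of q p v x] pqv by (auto simp: insert_commute)
  next
    fix p q assume pq: "p \<in> cube n" "q \<in> cube n" "red p \<noteq> red q"
    have "path_on (cube n - {p, q}) x y"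
      if "x \<in> cube n - {p, q}" "y \<in> cube n - {p, q}" "adj x y" for x y
      using that pq Suc.IH[of p q x y] Suc.IH[of q p x y] adj_red[OF that(3)]
      by (auto simp: insert_commute)
    then show "\<exists>w. \<forall>x\<in>cube n - {p, q, w}. \<forall>y\<in>cube n - {p, q, w}. adj x y \<longrightarrow>
        path_on (cube n - {p, q}) x y" by blast
  qed (use Suc.prems Suc.hyps in auto)
qed

section \<open>Four deleted vertices\<close>

text \<open>If each half has one fault of each colour, the path crosses once, or it stays in the half
of both ends except for a detour.\<close>

lemma faults_split_evenly:
  assumes n: "4 \<le> n" and i: "i \<le> n" and cd: "c \<noteq> d"
    and p: "p \<in> cube n" and h: "h \<in> cube n" and q: "q \<in> cube n" and k: "k \<in> cube n"
    and col: "red p \<noteq> red h" "red q = red h" "red k = red p"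
    and r: "r \<in> cube n" "red r = red p" "r \<noteq> p"
    and g: "g \<in> cube (Suc n)" "red g \<noteq> red (ins_bit i c r)" "g \<noteq> ins_bit i c h" "g \<noteq> ins_bit i d k"
  shows "path_on (cube (Suc n) - {ins_bit i c p, ins_bit i c h, ins_bit i d q, ins_bit i d k}) (ins_bit i c r) g"
proof -
  have eight: "2 ^ 3 \<le> (2::nat) ^ (n - 1)" using n by (intro power_increasing) auto
  let ?F = "{ins_bit i c p, ins_bit i c h, ins_bit i d q, ins_bit i d k}"
  have F: "?F = ins_bit i c ` {p, h} \<union> ins_bit i d ` {q, k}" by auto
  show ?thesis
  proof (cases rule: ins_bit_cases[OF g(1) i cd])
    case (1 g')
    then have g': "red g' = red h" "g' \<noteq> h" using g(2,3) r col by auto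
    have top: "path_on (cube n - {p, h}) r g'"
      using g' 1 r p h col n by (intro cube_minus_two_path) auto
    have "card {p, h} \<le> 2" by (simp add: card_insert_if)
    then have "length [q, k] < card {v \<in> cube n - {p, h}. red v \<noteq> red r}"
      using card_colour_class_minus[of "{p, h}" n "\<not> red r"] eight n by auto
    from path_on_cut_edge[OF top this] obtain x y where
      xy: "paths_on (cube n - {p, h}) r x y g'" "adj x y" "red x = red r" "x \<notin> set [q, k]"
        "y \<notin> set [q, k]" .
    have "path_on (cube n - {k, q}) x y"
      using xy adj_red[OF xy(2)] paths_on_ends[OF xy(1)] q k col r n
      by (intro cube_minus_two_path) auto
    then show ?thesis using detour[OF i cd F xy(1)] 1(2) by (simp add: insert_commute)
  next
    case (2 g')
    then have g': "red g' = red r" "g' \<noteq> k" using g(2,4) cd by auto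
    obtain x where x: "x \<in> cube n" "red x = red h" "x \<notin> set [h, q]"
      using ex_vertex_avoiding[of "[h, q]" n "red h"] eight n by auto
    have "path_on (cube n - {p, h}) r x" "path_on (cube n - {q, k}) x g'"
      using x 2(1) g' r p h q k col n by (auto intro!: cube_minus_two_path)
    then show ?thesis using cross_once[OF i cd F] 2(2) by simp
  qed
qed

text \<open>The first half has the single fault \<open>p\<close>, the second half the faults \<open>q\<close>, \<open>h\<close>, \<open>k\<close>, where
\<open>p\<close> and \<open>q\<close> have the same colour in the large cube, and so have \<open>h\<close> and \<open>k\<close>. In the second half,
\<open>k\<close> is at first kept, as an end or as an inner vertex of a path that avoids only \<open>q\<close> and \<open>h\<close>.\<close>

lemma red_fault_alone:
  assumes n: "4 \<le> n" and i: "i \<le> n" and cd: "c \<noteq> d"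
    and p: "p \<in> cube n" and q: "q \<in> cube n" and h: "h \<in> cube n" and k: "k \<in> cube n"
    and hk: "h \<noteq> k" and col: "red q \<noteq> red p" "red h = red p" "red k = red p"
    and r: "r \<in> cube (Suc n)" "red r = red (ins_bit i c p)" "r \<noteq> ins_bit i c p" "r \<noteq> ins_bit i d q"
    and g: "g \<in> cube (Suc n)" "red g \<noteq> red r" "g \<noteq> ins_bit i d h" "g \<noteq> ins_bit i d k"
  shows "path_on (cube (Suc n) - {ins_bit i c p, ins_bit i d q, ins_bit i d h, ins_bit i d k}) r g"
proof -
  have eight: "2 ^ 3 \<le> (2::nat) ^ (n - 1)" using n by (intro power_increasing) auto
  let ?F = "{ins_bit i c p, ins_bit i d q, ins_bit i d h, ins_bit i d k}"
  let ?B = "cube n - {q, h, k}"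
  have F: "?F = ins_bit i c ` {p} \<union> ins_bit i d ` {q, h, k}" by auto
  then have F': "?F = ins_bit i d ` {q, h, k} \<union> ins_bit i c ` {p}" by auto
  have B: "cube n - {q, h} - {k} = ?B" by auto
  \<comment> \<open>A path from \<open>u\<close> to \<open>k\<close> that avoids \<open>q\<close> and \<open>h\<close>, with its end \<open>k\<close> removed.\<close>
  have drop: "\<exists>z. path_on ?B u z \<and> z \<noteq> u \<and> z \<noteq> q \<and> red z = red q \<and> z \<in> cube n"
    if u: "u \<in> cube n" "red u = red q" "u \<noteq> q" for u
  proof -
    have "path_on (cube n - {q, h}) u k" "u \<noteq> k"
      using u q h k hk col n by (auto intro!: cube_minus_two_path)
    then obtain z where z: "path_on ?B u z" "adj z k"
      using path_on_drop_end[of "cube n - {q, h}" u k] B by metis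
    obtain y where "y \<in> cube n" "red y = red q" "y \<notin> set [q, u]"
      using ex_vertex_avoiding[of "[q, u]" n "red q"] eight n by auto
    then have "?B \<noteq> {u}" using col by auto
    then have "z \<noteq> u" using path_on_same_ends[OF z(1)] by auto
    then show ?thesis using z path_on_ends[OF z(1)] adj_red[OF z(2)] col by auto
  qed
  show ?thesis
  proof (cases rule: ins_bit_cases[OF r(1) i cd]; cases rule: ins_bit_cases[OF g(1) i cd])
    fix r' g' assume r': "r' \<in> cube n" "r = ins_bit i c r'"
      and g': "g' \<in> cube n" "g = ins_bit i c g'"
    have rg: "red r' = red p" "r' \<noteq> p" "red g' = red q" using r(2,3) g(2) col by (auto simp: r' g')
    \<comment> \<open>The end \<open>g\<close> is reached from its twin in the other half, which is possible unless that
      twin is the fault \<open>q\<close>. If it is, the covering by a neutral and a charged path takes over.\<close>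
    show ?thesis
    proof (cases "g' = q")
      case False
      then obtain z where z: "path_on ?B g' z" "z \<noteq> g'" "red z = red q" "z \<in> cube n"
        using drop[OF g'(1) rg(3)] by blast
      have "path_on (cube n - {p, g'}) r' z"
        using z p r' g' rg col n by (intro cube_minus_two_path) auto
      then have "paths_on (cube n - {p}) r' z g' g'"
        using g' rg col by (intro paths_onI[OF _ path_on.single]) auto
      from detour[OF i cd F this path_on_rev[OF z(1)]] show ?thesis by (simp add: r' g')
    next
      case True
      obtain x where x: "x \<in> cube n" "red x = red q" "x \<notin> set [q]"
        using ex_vertex_avoiding[of "[q]" n "red q"] eight n by auto
      then obtain z where z: "path_on ?B x z" "z \<noteq> x" "z \<noteq> q" "red z = red q" "z \<in> cube n"
        using drop[of x] by auto
      have "paths_on (cube n - {p}) r' x g' z"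
        using x z p r' g' rg True col n by (intro cube_minus_one_two_paths) auto
      from detour[OF i cd F paths_on_rev2[OF this] z(1)] show ?thesis by (simp add: r' g')
    qed
  next
    fix r' g' assume r': "r' \<in> cube n" "r = ins_bit i c r'"
      and g': "g' \<in> cube n" "g = ins_bit i d g'"
    have rg: "red r' = red p" "r' \<noteq> p" "red g' = red p" "g' \<noteq> h" "g' \<noteq> k"
      using r(2,3) g(2-4) col cd by (auto simp: r' g')
    \<comment> \<open>The entry vertex \<open>x\<close> must not be adjacent to \<open>k\<close>: otherwise the path from \<open>x\<close> could
      meet \<open>k\<close> next, and removing \<open>k\<close> would isolate \<open>x\<close>, whose only way out is its twin, already
      used. In all, \<open>n + 1\<close> vertices are to be avoided.\<close>
    have "m + 2 < 2 ^ m" if "3 \<le> m" for m :: nat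
      using that by (induction m rule: nat_induct_at_least) auto
    from this[of "n - 1"]
    have "length (q # map (\<lambda>j. k[j := \<not> k ! j]) [0..<n]) < 2 ^ (n - 1)"
      using n by auto
    moreover have "0 < n" using n by simp
    ultimately obtain x where x: "x \<in> cube n" "red x = red q"
        "x \<notin> set (q # map (\<lambda>j. k[j := \<not> k ! j]) [0..<n])"
      by (rule ex_vertex_avoiding)
    have "\<not> adj x k" using adj_imp_flip[of x k] x(3) k by (auto simp: cube_def)
    moreover have "path_on (cube n - {q, h}) x g'"
      using x q h g' rg col n by (intro cube_minus_two_path) auto
    then obtain a b where ab: "paths_on ?B x a b g'" "adj a k" "adj k b"
      using path_on_remove_vertex[of "cube n - {q, h}" x g' k] B k hk x rg col by (metis Diff_iff insertE singletonD)
    ultimately have "x \<noteq> a" by blast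
    then have "paths_on (cube n - {p}) r' x a b"
      using x paths_on_ends[OF ab(1)] adj_red[OF ab(2)] adj_red[OF ab(3)] p r' rg col n
      by (intro cube_minus_one_two_paths) auto
    from cross_thrice[OF i cd F this ab(1)] show ?thesis by (simp add: r' g')
  next
    fix r' g' assume r': "r' \<in> cube n" "r = ins_bit i d r'"
      and g': "g' \<in> cube n" "g = ins_bit i c g'"
    have rg: "red r' = red q" "r' \<noteq> q" "red g' = red q"
      using r(2,4) g(2) col cd by (auto simp: r' g')
    then obtain z where z: "path_on ?B r' z" "red z = red q" "z \<in> cube n"
      using drop[OF r'(1)] by blast
    show ?thesis
    proof (cases "z = g'")
      case False
      have "path_on (cube n - {p}) z g'"
        using False z g' rg p col n by (intro cube_minus_one_path) auto
      from cross_once[OF i cd[symmetric] F' z(1) this] show ?thesis by (simp add: r' g')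
    next
      case True
      \<comment> \<open>The path in the second half ends at the twin of \<open>g\<close>, so it can be followed by \<open>g\<close>
        alone. The rest of the first half is covered by a detour from some edge of this path.\<close>
      have "card {q, h, k} \<le> 3" by (simp add: card_insert_if)
      then have "length [p, g'] < card {v \<in> ?B. red v \<noteq> red r'}"
        using card_colour_class_minus[of "{q, h, k}" n "\<not> red r'"] eight n by auto
      from path_on_cut_edge[OF z(1) this] obtain x y where
        xy: "paths_on ?B r' x y z" "adj x y" "red x = red r'" "x \<notin> set [p, g']" "y \<notin> set [p, g']" .
      have "path_on (cube n - {g', p}) x y"
        using xy paths_on_ends[OF xy(1)] adj_red[OF xy(2)] rg p g' col n
        by (intro cube_minus_two_path) auto
      then have "paths_on (cube n - {p}) x y g' g'"
        using g' rg col by (intro paths_onI[OF _ path_on.single]) auto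
      then show ?thesis using cross_thrice[OF i cd[symmetric] F'] xy(1) True by (simp add: r' g')
    qed
  next
    fix r' g' assume r': "r' \<in> cube n" "r = ins_bit i d r'"
      and g': "g' \<in> cube n" "g = ins_bit i d g'"
    have rg: "red r' = red q" "r' \<noteq> q" "red g' = red p" "g' \<noteq> h" "g' \<noteq> k"
      using r(2,4) g(2-4) col cd by (auto simp: r' g')
    have "path_on (cube n - {q, h}) r' g'"
      using q h r' g' rg col n by (intro cube_minus_two_path) auto
    then obtain x y where xy: "paths_on ?B r' x y g'" "adj x k" "adj k y"
      using path_on_remove_vertex[of "cube n - {q, h}" r' g' k] B k hk rg col
      by (metis Diff_iff insertE singletonD)
    have "path_on (cube n - {p}) x y"
      using paths_on_ends[OF xy(1)] adj_red[OF xy(2)] adj_red[OF xy(3)] p col n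
      by (intro cube_minus_one_path) auto
    from detour[OF i cd[symmetric] F' xy(1) this] show ?thesis by (simp add: r' g')
  qed
qed

text \<open>A coordinate separating \<open>r\<^sub>1\<close> and \<open>r\<^sub>2\<close> either separates \<open>g\<^sub>1\<close> and \<open>g\<^sub>2\<close> as well, or
leaves one of the red faults alone in its half.\<close>

lemma cube_minus_four_path:
  assumes "5 \<le> n"
    and verts: "r \<in> cube n" "r1 \<in> cube n" "r2 \<in> cube n" "g \<in> cube n" "g1 \<in> cube n" "g2 \<in> cube n"
    and dist: "distinct [r, r1, r2]" "distinct [g, g1, g2]"
    and col: "red r1 = red r" "red r2 = red r" "red g1 = red g" "red g2 = red g" "red r \<noteq> red g"
  shows "path_on (cube n - {r1, r2, g1, g2}) r g"
proof -
  from \<open>5 \<le> n\<close> obtain m where m: "n = Suc m" "4 \<le> m" by (cases n) auto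
  note vs = verts[unfolded m(1)]
  obtain i c d p q where i: "i \<le> m" and cd: "c \<noteq> d" and p: "p \<in> cube m" "r1 = ins_bit i c p"
    and q: "q \<in> cube m" "r2 = ins_bit i d q"
    using separating_coordinate vs(2,3) dist(1) by (metis distinct_length_2_or_more)
  have pq: "red q \<noteq> red p" using col cd by (auto simp: p q)
  have rr: "red r1 = red r" "red r2 = red r" "red r \<noteq> red g" "r \<noteq> r1" "r \<noteq> r2"
    using col dist by auto
  have even: "path_on (cube (Suc m) - {r1, r2, g1, g2}) r g"
    if h: "h \<in> cube m" "g1 = ins_bit i c h" and k: "k \<in> cube m" "g2 = ins_bit i d k"
      and dist: "distinct [g, g1, g2]" and col: "red g1 = red g" "red g2 = red g" for h k g1 g2
  proof -
    have hk: "red p \<noteq> red h" "red q = red h" "red k = red p"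
      using col rr pq cd by (auto simp: p h k)
    show ?thesis
    proof (cases rule: ins_bit_cases[OF vs(1) i cd])
      case (1 r')
      have "path_on (cube (Suc m) - {r1, g1, r2, g2}) r g"
        unfolding p(2) q(2) h(2) k(2) 1(2)
        by (rule faults_split_evenly[OF m(2) i cd p(1) h(1) q(1) k(1) hk 1(1) _ _ vs(4)])
          (use 1(2) p h k dist col rr in auto)
      then show ?thesis by (simp add: insert_commute)
    next
      case (2 r')
      have "path_on (cube (Suc m) - {r2, g2, r1, g1}) r g"
        unfolding p(2) q(2) h(2) k(2) 2(2)
        by (rule faults_split_evenly[OF m(2) i cd[symmetric] q(1) k(1) p(1) h(1) _ _ _ 2(1) _ _ vs(4)])
          (use 2(2) q h k hk pq dist col rr in auto)
      then show ?thesis by (simp add: insert_commute)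
    qed
  qed
  have "path_on (cube (Suc m) - {r1, r2, g1, g2}) r g"
  proof (cases rule: ins_bit_cases[OF vs(5) i cd]; cases rule: ins_bit_cases[OF vs(6) i cd])
    fix h k assume h: "h \<in> cube m" "g1 = ins_bit i c h" and k: "k \<in> cube m" "g2 = ins_bit i c k"
    have "red h = red q" "red k = red q" "h \<noteq> k" using col dist cd by (auto simp: p q h k)
    then have "path_on (cube (Suc m) - {r2, r1, g1, g2}) r g"
      unfolding p(2) q(2) h(2) k(2)
      by (intro red_fault_alone[OF m(2) i cd[symmetric] q(1) p(1) h(1) k(1) _ _ _ _ vs(1) _ _ _ vs(4)])
        (use p(2) q(2) h(2) k(2) pq col dist in auto)
    then show ?thesis by (simp add: insert_commute)
  next
    fix h k assume "h \<in> cube m" "g1 = ins_bit i c h" "k \<in> cube m" "g2 = ins_bit i d k"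
    then show ?thesis using even[of h g1 k g2] dist col by simp
  next
    fix h k assume "h \<in> cube m" "g1 = ins_bit i d h" "k \<in> cube m" "g2 = ins_bit i c k"
    then show ?thesis using even[of k g2 h g1] dist col by (auto simp: insert_commute)
  next
    fix h k assume h: "h \<in> cube m" "g1 = ins_bit i d h" and k: "k \<in> cube m" "g2 = ins_bit i d k"
    have "red h = red p" "red k = red p" "h \<noteq> k" using col dist cd by (auto simp: p q h k)
    then show ?thesis
      unfolding p(2) q(2) h(2) k(2)
      by (intro red_fault_alone[OF m(2) i cd p(1) q(1) h(1) k(1) _ _ _ _ vs(1) _ _ _ vs(4)])
        (use p(2) q(2) h(2) k(2) pq col dist in auto)
  qed
  then show ?thesis unfolding m(1) .
qed

section \<open>Coverings of faulty hypercubes by one neutral path\<close>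

lemma adj_iff_card:
  "length u = length v \<Longrightarrow> adj u v \<longleftrightarrow> card {i. i < length u \<and> u ! i \<noteq> v ! i} = 1"
proof (induction u v rule: adj.induct)
  case (1 x u y v)
  let ?D = "{i. i < length u \<and> u ! i \<noteq> v ! i}"
  have "{i. i < length (x # u) \<and> (x # u) ! i \<noteq> (y # v) ! i} = (if x = y then {} else {0}) \<union> Suc ` ?D"
    by (auto simp: less_Suc_eq_0_disj image_iff)
  then have "card {i. i < length (x # u) \<and> (x # u) ! i \<noteq> (y # v) ! i} = (if x = y then 0 else 1) + card ?D"
    by (simp add: card_image)
  moreover have "card ?D = 0 \<longleftrightarrow> u = v"
    using 1(2) by (auto simp: card_eq_0_iff intro: nth_equalityI)
  ultimately show ?case using 1 by auto
qed auto

lemma verts_delete [simp]: "verts (delete_verts (hypercube n) F) = cube n - F"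
  by (simp add: delete_verts_def hypercube_def cube_def)

lemma arcs_ends_delete:
  "arcs_ends (delete_verts (hypercube n) F) = {(u, v). u \<in> cube n - F \<and> v \<in> cube n - F \<and> adj u v}"
  by (auto simp: arcs_ends_def arc_to_ends_def delete_verts_def hypercube_def cube_def adj_iff_card
      image_iff)

lemma path_on_imp_vpath:
  "path_on S a b \<Longrightarrow> S \<subseteq> cube n - F \<Longrightarrow>
    \<exists>p. vpath p (delete_verts (hypercube n) F) \<and> set p = S \<and> hd p = a \<and> last p = b"
proof (induction rule: path_on.induct)
  case (single a)
  then show ?case by (intro exI[of _ "[a]"]) (auto simp: vpath_def vwalk_def)
next
  case (step S b c a)
  then obtain p where p: "vpath p (delete_verts (hypercube n) F)" "set p = S" "hd p = b" "last p = c"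
    by auto
  have "b \<in> S" using path_on_ends[OF step.hyps(1)] by simp
  then have "p \<noteq> []" "(a, hd p) \<in> arcs_ends (delete_verts (hypercube n) F)"
    using p step by (auto simp: arcs_ends_delete)
  then show ?case
    using p step by (intro exI[of _ "a # p"]) (auto simp: vpath_def intro!: vwalk_consI)
qed

text \<open>Together with the previous lemma, this allows arguing with \<open>path_on\<close> alone.\<close>

lemma vpath_imp_path_on:
  "vpath p (delete_verts (hypercube n) F) \<Longrightarrow> path_on (set p) (hd p) (last p)"
proof (induction p)
  case (Cons a p)
  show ?case
  proof (cases "p = []")
    case False
    then have "adj a (hd p)" "vwalk p (delete_verts (hypercube n) F)"
      using Cons.prems by (auto simp: vpath_def arcs_ends_delete elim!: vwalk_consE)
    then show ?thesis
      using Cons False path_on.step[of "set p" "hd p" "last p" a] by (auto simp: vpath_def)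
  qed (simp add: path_on.single)
qed (auto simp: vpath_def vwalk_def)

lemma hamiltonian_path_iff_path_on:
  "(\<exists>p. hamiltonian_path (delete_verts (hypercube n) F) p \<and> hd p = a \<and> last p = b)
    \<longleftrightarrow> path_on (cube n - F) a b"
proof
  assume "\<exists>p. hamiltonian_path (delete_verts (hypercube n) F) p \<and> hd p = a \<and> last p = b"
  then obtain p where "vpath p (delete_verts (hypercube n) F)" "set p = cube n - F" "hd p = a" "last p = b"
    by (auto simp: hamiltonian_path_def)
  then show "path_on (cube n - F) a b" using vpath_imp_path_on by metis
next
  assume "path_on (cube n - F) a b"
  from path_on_imp_vpath[OF this subset_refl]
  show "\<exists>p. hamiltonian_path (delete_verts (hypercube n) F) p \<and> hd p = a \<and> last p = b"
    by (simp add: hamiltonian_path_def)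
qed

lemma three_red_three_green_path:
  assumes "5 \<le> n" "three_red_three_green n r r1 r2 g g1 g2"
  shows "path_on (cube n - {r1, r2, g1, g2}) r g"
  using assms by (intro cube_minus_four_path) (auto simp: three_red_three_green_def hypercube_def cube_def green_iff)

text \<open>Every pair is neutral or charged. Since there are finitely many pairs and no charged one
among them, the neutral pair is the only one.\<close>

lemma admissible_ends_one_neutral:
  assumes "admissible_ends n F 1 0 E"
  obtains r g where "E = {{r, g}}" "r \<in> cube n - F" "g \<in> cube n - F" "red r" "\<not> red g"
proof -
  from assms have pairs: "\<And>e. e \<in> E \<Longrightarrow> is_pair e \<and> e \<subseteq> cube n - F"
    and one: "card {e \<in> E. neutral_pair e} = 1" and none: "card {e \<in> E. charged_pair e} = 0"
    by (auto simp: admissible_ends_def in_balance_def)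
  have "finite E"
    using pairs by (intro finite_subset[of E "Pow (cube n)"]) auto
  then have "\<not> charged_pair e" if "e \<in> E" for e using none that by auto
  then have neutral: "neutral_pair e" if "e \<in> E" for e
    using pairs[OF that] that
    by (auto simp: charged_pair_def red_pair_def green_pair_def neutral_pair_def green_iff)
  then have "{e \<in> E. neutral_pair e} = E" by auto
  with one obtain e where e: "E = {e}" by (auto simp: card_1_singleton_iff)
  then have "neutral_pair e" using neutral by simp
  then obtain r g where rg: "r \<in> e" "g \<in> e" "red r" "\<not> red g" "card e = 2"
    by (auto simp: neutral_pair_def is_pair_def green_iff)
  then have "e = {r, g}" by (auto simp: card_2_iff)
  with rg e pairs[of e] show ?thesis by (intro that) auto
qed

lemma neutral_pair_admissible:
  assumes "r \<in> cube n - F" "g \<in> cube n - F" "red r" "\<not> red g" "num_red F = num_green F"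
  shows "admissible_ends n F 1 0 {{r, g}}"
proof -
  have "r \<noteq> g" using assms by auto
  then have "is_pair {r, g}" by (simp add: is_pair_def)
  then have "neutral_pair {r, g}" "\<not> red_pair {r, g}" "\<not> green_pair {r, g}"
    using assms by (auto simp: neutral_pair_def red_pair_def green_pair_def green_iff)
  then have classes: "{e \<in> {{r, g}}. neutral_pair e} = {{r, g}}" "{e \<in> {{r, g}}. charged_pair e} = {}"
    "{e \<in> {{r, g}}. red_pair e} = {}" "{e \<in> {{r, g}}. green_pair e} = {}"
    by (auto simp: charged_pair_def)
  show ?thesis
    unfolding admissible_ends_def in_balance_def classes
    using assms \<open>is_pair {r, g}\<close> by (simp add: pairwise_def)
qed

text \<open>All paths of such a covering contain \<open>r\<close>, so by disjointness there is just one. It may run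
from \<open>g\<close> to \<open>r\<close>, in which case it is reversed.\<close>

lemma covering_one_pair_iff:
  "(\<exists>P. path_covering (delete_verts (hypercube n) F) P \<and> path_ends ` P = {{r, g}})
    \<longleftrightarrow> path_on (cube n - F) r g"
proof
  assume "path_on (cube n - F) r g"
  then obtain p where "vpath p (delete_verts (hypercube n) F)" "set p = cube n - F" "hd p = r" "last p = g"
    using path_on_imp_vpath by blast
  then show "\<exists>P. path_covering (delete_verts (hypercube n) F) P \<and> path_ends ` P = {{r, g}}"
    by (intro exI[of _ "{p}"]) (simp add: path_covering_def path_ends_def)
next
  assume "\<exists>P. path_covering (delete_verts (hypercube n) F) P \<and> path_ends ` P = {{r, g}}"
  then obtain P where P: "\<And>p. p \<in> P \<Longrightarrow> vpath p (delete_verts (hypercube n) F)"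
    "pairwise (\<lambda>p q. disjnt (set p) (set q)) P" "(\<Union>p\<in>P. set p) = cube n - F"
    "path_ends ` P = {{r, g}}" by (auto simp: path_covering_def)
  have path_ends: "path_ends q = {r, g}" if "q \<in> P" for q using P(4) that by blast
  obtain p where "p \<in> P" using P(4) by blast
  note p = this path_ends[OF this]
  have ends: "r \<in> set q" if "q \<in> P" for q
  proof -
    have "r \<in> path_ends q" using path_ends[OF that] by simp
    then show ?thesis using path_on_ends[OF vpath_imp_path_on[OF P(1)[OF that]]]
      by (auto simp: path_ends_def)
  qed
  have "P = {p}"
  proof -
    have "q = p" if "q \<in> P" for q
      using pairwiseD[OF P(2) that p(1)] ends[OF that] ends[OF p(1)] by (meson disjnt_iff)
    then show ?thesis using p(1) by blast
  qed
  then have "path_on (cube n - F) (hd p) (last p)"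
    using vpath_imp_path_on[OF P(1)[OF p(1)]] P(3) by simp
  moreover have "(hd p = r \<and> last p = g) \<or> (hd p = g \<and> last p = r)"
    using p(2) by (auto simp: path_ends_def doubleton_eq_iff)
  ultimately show "path_on (cube n - F) r g" using path_on_rev by auto
qed

lemma freely_prescribe_one_neutral_iff:
  assumes "num_red F = num_green F" "\<exists>r\<in>cube n - F. red r" "\<exists>g\<in>cube n - F. \<not> red g"
  shows "freely_prescribe_ends n F 1 0 \<longleftrightarrow>
    (\<forall>r\<in>cube n - F. \<forall>g\<in>cube n - F. red r \<and> \<not> red g \<longrightarrow> path_on (cube n - F) r g)" (is "?L \<longleftrightarrow> ?R")
proof
  assume ?L
  then show ?R
    using neutral_pair_admissible assms(1) covering_one_pair_iff
    unfolding freely_prescribe_ends_def by metis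
next
  assume R: ?R
  have "\<exists>E. admissible_ends n F 1 0 E" using neutral_pair_admissible assms by metis
  moreover have "\<exists>P. path_covering (delete_verts (hypercube n) F) P \<and> path_ends ` P = E"
    if E: "admissible_ends n F 1 0 E" for E
    using admissible_ends_one_neutral[OF E] R covering_one_pair_iff by metis
  ultimately show ?L by (auto simp: freely_prescribe_ends_def)
qed

lemma neutral_fault_of_mass_four:
  assumes "mass F = 4" "charge F = 0"
  obtains r1 r2 g1 g2 where "F = {r1, r2, g1, g2}" "red r1" "red r2" "r1 \<noteq> r2"
    "\<not> red g1" "\<not> red g2" "g1 \<noteq> g2"
proof -
  have fin: "finite F" using assms(1) by (intro card_ge_0_finite) (simp add: mass_def)
  have "F = {v \<in> F. red v} \<union> {v \<in> F. green v}" by (auto simp: green_iff)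
  then have "card F = num_red F + num_green F"
    unfolding num_red_def num_green_def
    using fin by (subst card_Un_disjoint[symmetric]) (auto simp: green_iff)
  then have "card {v \<in> F. red v} = 2" "card {v \<in> F. green v} = 2"
    using assms by (auto simp: mass_def charge_def num_red_def num_green_def)
  then obtain r1 r2 g1 g2 where rg: "{v \<in> F. red v} = {r1, r2}" "r1 \<noteq> r2"
    "{v \<in> F. green v} = {g1, g2}" "g1 \<noteq> g2" by (auto simp: card_2_iff)
  have "F = {r1, r2} \<union> {g1, g2}" unfolding rg(1,3)[symmetric] by (auto simp: green_iff)
  moreover have "red r1" "red r2" "\<not> red g1" "\<not> red g2" using rg by (auto simp: green_iff)
  ultimately show ?thesis using rg that[of r1 r2 g1 g2] by auto
qed

lemma num_red_num_green_four:
  assumes "red r1" "red r2" "r1 \<noteq> r2" "\<not> red g1" "\<not> red g2" "g1 \<noteq> g2"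
  shows "num_red {r1, r2, g1, g2} = 2" "num_green {r1, r2, g1, g2} = 2"
proof -
  have "{v \<in> {r1, r2, g1, g2}. red v} = {r1, r2}" "{v \<in> {r1, r2, g1, g2}. green v} = {g1, g2}"
    using assms by (auto simp: green_iff)
  then show "num_red {r1, r2, g1, g2} = 2" "num_green {r1, r2, g1, g2} = 2"
    using assms by (auto simp: num_red_def num_green_def)
qed

lemma five_in_A_set: "5 \<in> A_set 4 0 1 0"
proof -
  have "freely_prescribe_ends n F 1 0" if n: "5 \<le> n" and F: "fault n F" "mass F = 4" "charge F = 0" for n F
  proof -
    obtain r1 r2 g1 g2 where rg: "F = {r1, r2, g1, g2}" "red r1" "red r2" "r1 \<noteq> r2"
      "\<not> red g1" "\<not> red g2" "g1 \<noteq> g2" using neutral_fault_of_mass_four[OF F(2,3)] by blast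
    have verts: "r1 \<in> cube n" "r2 \<in> cube n" "g1 \<in> cube n" "g2 \<in> cube n"
      using F(1) rg(1) by (simp_all add: fault_def hypercube_def cube_def)
    have balanced: "num_red F = num_green F" using num_red_num_green_four[OF rg(2-7)] rg(1) by simp
    have "2 ^ 4 \<le> (2::nat) ^ (n - 1)" using n by (intro power_increasing) auto
    then have long: "length [r1, r2, g1, g2] < 2 ^ (n - 1)" "0 < n" using n by auto
    have remaining: "\<exists>v\<in>cube n - F. red v = c" for c
      by (rule ex_vertex_avoiding[OF long, of c]) (auto simp: rg(1))
    have "path_on (cube n - F) r g" if "r \<in> cube n - F" "g \<in> cube n - F" "red r" "\<not> red g" for r g
      unfolding rg(1) by (rule cube_minus_four_path[OF n]) (use that verts rg in auto)
    then show ?thesis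
      using freely_prescribe_one_neutral_iff[OF balanced] remaining[of True] remaining[of False] by simp
  qed
  moreover have "log 2 6 \<le> 5" by (simp add: log_le_iff)
  ultimately show ?thesis by (simp add: A_set_def)
qed

lemma A_set_at_least_five: "m \<in> A_set 4 0 1 0 \<Longrightarrow> 5 \<le> m"
proof (rule ccontr)
  assume m: "m \<in> A_set 4 0 1 0" "\<not> 5 \<le> m"
  let ?r1 = "[False,False,True,True]" and ?r2 = "[False,True,False,True]"
    and ?g1 = "[True,False,False,False]" and ?g2 = "[True,True,True,False]"
    and ?r = "[False,False,False,False]" and ?g = "[True,False,True,True]"
  let ?F = "{?r1, ?r2, ?g1, ?g2}"
  have rg: "?r \<in> cube 4 - ?F" "?g \<in> cube 4 - ?F" "red ?r" "\<not> red ?g" by (auto simp: cube_def)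
  have balanced: "num_red ?F = 2" "num_green ?F = 2" by (rule num_red_num_green_four; simp)+
  have eq: "num_red ?F = num_green ?F" using balanced by simp
  have ex: "\<exists>r\<in>cube 4 - ?F. red r" "\<exists>g\<in>cube 4 - ?F. \<not> red g" using rg by blast+
  have "fault 4 ?F" "mass ?F = 4" "charge ?F = 0"
    using balanced by (simp_all add: fault_def hypercube_def mass_def charge_def)
  then have "freely_prescribe_ends 4 ?F 1 0" using m unfolding A_set_def by auto
  then have "path_on (cube 4 - ?F) ?r ?g"
    using freely_prescribe_one_neutral_iff[OF eq ex] rg by blast
  then show False using cube4_counterexample by simp
qed

theorem lemma4p6:
  shows "(A_set 4 0 1 0 \<noteq> {} \<and> bracket 4 0 1 0 = 5) \<and>
    (\<forall>n\<ge>5. \<forall>r r1 r2 g g1 g2. three_red_three_green n r r1 r2 g g1 g2 \<longrightarrow>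
      (\<exists>p. hamiltonian_path (delete_verts (hypercube n) {r1, r2, g1, g2}) p
         \<and> hd p = r \<and> last p = g)) \<and>
    (\<forall>n\<in>{3, 4}. \<exists>r r1 r2 g g1 g2. three_red_three_green n r r1 r2 g g1 g2 \<and>
      \<not> (\<exists>p. hamiltonian_path (delete_verts (hypercube n) {r1, r2, g1, g2}) p
         \<and> hd p = r \<and> last p = g))"
proof (intro conjI)
  show "A_set 4 0 1 0 \<noteq> {}" using five_in_A_set by blast
  show "bracket 4 0 1 0 = 5"
    unfolding bracket_def using five_in_A_set A_set_at_least_five by (intro Least_equality)
  show "\<forall>n\<ge>5. \<forall>r r1 r2 g g1 g2. three_red_three_green n r r1 r2 g g1 g2 \<longrightarrow>
      (\<exists>p. hamiltonian_path (delete_verts (hypercube n) {r1, r2, g1, g2}) p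
         \<and> hd p = r \<and> last p = g)"
    unfolding hamiltonian_path_iff_path_on using three_red_three_green_path by blast
  have "three_red_three_green 3 [False,False,False] [False,True,True] [True,False,True]
      [False,False,True] [False,True,False] [True,False,False]"
    "three_red_three_green 4 [False,False,False,False] [False,False,True,True] [False,True,False,True]
      [True,False,True,True] [True,False,False,False] [True,True,True,False]"
    by (simp_all add: three_red_three_green_def hypercube_def green_iff)
  then show "\<forall>n\<in>{3, 4}. \<exists>r r1 r2 g g1 g2. three_red_three_green n r r1 r2 g g1 g2 \<and>
      \<not> (\<exists>p. hamiltonian_path (delete_verts (hypercube n) {r1, r2, g1, g2}) p
         \<and> hd p = r \<and> last p = g)"
    unfolding hamiltonian_path_iff_path_on
    using cube3_counterexample cube4_counterexample by blast
qed

end
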